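(* Let $O$ be the order polytope of a finite poset. There is a graph $\Delta$ such that $O$ has exactly $\frac{1}{2}\alpha(\Delta)$ visibility sets, of which exactly $\frac{1}{2}\alpha(\Delta)-\beta(\Delta)$ are visible from far away.
   Context: Graphs are finite, connected, undirected, with no loops or multiple edges. For a graph $\Delta$, $\alpha(\Delta)$ is the number of acyclic orientations of $\Delta$, and $\beta(\Delta)=|\chi_\Delta'(1)|$ is its beta invariant, where $\chi_\Delta'$ is the derivative of the chromatic polynomial $\chi_\Delta$. The order polytope of a finite poset $P$ is the convex polytope $O\subset\mathbb{R}^P$ of all order-preserving functions $P\to[0,1]$. The visibility arrangement of $O$ is the set of affine spans of the facets of $O$, a hyperplane arrangement in $\mathbb{R}^P$. For a point $x\in\mathbb{R}^P$ not on any hyperplane of this arrangement, a facet $F$ of $O$ is visible from $x$ if for $y$ in the relative interior of $F$ the segment $[x,y]$ meets the boundary of $O$ only at $y$ (so all facets are visible from interior points of $O$, and from a point $x\notin O$ the visible facets are those whose affine span strictly separates $x$ from the interior of $O$). A visibility set of $O$ is the set of all facets visible from some such point $x$. Visibility sets correspond bijectively to the chambers of the visibility arrangement (connected components of the complement of its hyperplanes). A visibility set is visible from far away if it is the set of facets visible from such points $x$ of arbitrarily large norm; equivalently, the corresponding chamber is unbounded. *)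

theory Defs
  imports "HOL-Analysis.Analysis" "HOL-Computational_Algebra.Polynomial"
begin

section \<open>Graphs, acyclic orientations and the beta invariant\<close>

definition simple_graph :: "'v set \<Rightarrow> 'v set set \<Rightarrow> bool" where
  "simple_graph V E \<longleftrightarrow> finite V \<and> E \<subseteq> {e. e \<subseteq> V \<and> card e = 2}"

definition connected_graph :: "'v set \<Rightarrow> 'v set set \<Rightarrow> bool" where
  "connected_graph V E \<longleftrightarrow>
     V \<noteq> {} \<and> (\<forall>u\<in>V. \<forall>v\<in>V. (u, v) \<in> {(a, b). {a, b} \<in> E}\<^sup>*)"

definition orientations :: "'v set set \<Rightarrow> ('v \<times> 'v) set set" where
  "orientations E = {D. (\<forall>u v. (u, v) \<in> D \<longrightarrow> {u, v} \<in> E) \<and>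
     (\<forall>u v. {u, v} \<in> E \<longrightarrow> ((u, v) \<in> D \<longleftrightarrow> (v, u) \<notin> D))}"

definition num_acyclic_orientations :: "'v set set \<Rightarrow> nat" where
  "num_acyclic_orientations E = card {D \<in> orientations E. acyclic D}"

definition proper_colourings :: "'v set \<Rightarrow> 'v set set \<Rightarrow> nat \<Rightarrow> ('v \<Rightarrow> nat) set" where
  "proper_colourings V E q =
     {f \<in> V \<rightarrow>\<^sub>E {..<q}. \<forall>u v. {u, v} \<in> E \<longrightarrow> f u \<noteq> f v}"

definition chromatic_polynomial :: "'v set \<Rightarrow> 'v set set \<Rightarrow> real poly" where
  "chromatic_polynomial V E =
     (THE p. \<forall>q. poly p (of_nat q) = of_nat (card (proper_colourings V E q)))"

definition beta_invariant :: "'v set \<Rightarrow> 'v set set \<Rightarrow> real" where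
  "beta_invariant V E = \<bar>poly (pderiv (chromatic_polynomial V E)) 1\<bar>"

text \<open>The definite description above denotes: a proper colouring with \<open>q\<close> colours is
  determined by its set \<open>S\<close> of used colours and a colouring onto \<open>S\<close>, so the number of
  proper colourings is a linear combination of binomial coefficients \<open>q choose k\<close>.\<close>

lemma card_proper_colourings_onto:
  assumes V: "finite V" and E: "E \<subseteq> Pow V" and S: "finite S"
  shows "card {f \<in> V \<rightarrow>\<^sub>E S. f ` V = S \<and> (\<forall>u v. {u, v} \<in> E \<longrightarrow> f u \<noteq> f v)} =
         card {f \<in> V \<rightarrow>\<^sub>E {..<card S}. f ` V = {..<card S} \<and>
                 (\<forall>u v. {u, v} \<in> E \<longrightarrow> f u \<noteq> f v)}"
    (is "card ?A = card ?B")
proof -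
  obtain h where h: "bij_betw h S {..<card S}"
    using ex_bij_betw_finite_nat[OF S] by (auto simp: atLeast0LessThan)
  define g where "g = inv_into S h"
  have g: "bij_betw g {..<card S} S"
    unfolding g_def using h by (rule bij_betw_inv_into)
  have gh: "g (h x) = x" if "x \<in> S" for x
    unfolding g_def using h that by (simp add: bij_betw_inv_into_left)
  have hg: "h (g x) = x" if "x < card S" for x
    unfolding g_def using h that by (simp add: bij_betw_inv_into_right)
  have edge: "u \<in> V \<and> v \<in> V" if "{u, v} \<in> E" for u v
    using E that by auto
  have hS: "h ` S = {..<card S}" and gS: "g ` {..<card S} = S"
    by (rule bij_betw_imp_surj_on[OF h], rule bij_betw_imp_surj_on[OF g])
  have "bij_betw (\<lambda>f. restrict (h \<circ> f) V) ?A ?B"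
  proof (rule bij_betw_byWitness[where f' = "\<lambda>f. restrict (g \<circ> f) V"])
    show "\<forall>f\<in>?A. restrict (g \<circ> restrict (h \<circ> f) V) V = f"
    proof
      fix f assume f: "f \<in> ?A"
      then have f: "f \<in> V \<rightarrow>\<^sub>E S" by blast
      have "restrict (g \<circ> restrict (h \<circ> f) V) V x = f x" for x
        using PiE_mem[OF f, of x] by (cases "x \<in> V") (simp_all add: gh PiE_arb[OF f])
      then show "restrict (g \<circ> restrict (h \<circ> f) V) V = f" by blast
    qed
    show "\<forall>f\<in>?B. restrict (h \<circ> restrict (g \<circ> f) V) V = f"
    proof
      fix f assume f: "f \<in> ?B"
      then have f: "f \<in> V \<rightarrow>\<^sub>E {..<card S}" by blast
      have "restrict (h \<circ> restrict (g \<circ> f) V) V x = f x" for x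
        using PiE_mem[OF f, of x] by (cases "x \<in> V") (simp_all add: hg PiE_arb[OF f])
      then show "restrict (h \<circ> restrict (g \<circ> f) V) V = f" by blast
    qed
    show "(\<lambda>f. restrict (h \<circ> f) V) ` ?A \<subseteq> ?B"
    proof (rule image_subsetI)
      fix f assume "f \<in> ?A"
      then have f: "f \<in> V \<rightarrow>\<^sub>E S" and im: "f ` V = S"
        and p: "\<forall>u v. {u, v} \<in> E \<longrightarrow> f u \<noteq> f v" by blast+
      have "restrict (h \<circ> f) V \<in> V \<rightarrow>\<^sub>E {..<card S}"
        using PiE_mem[OF f] hS by fastforce
      moreover have "restrict (h \<circ> f) V ` V = {..<card S}"
        unfolding image_restrict_eq image_comp[symmetric] im hS by (rule refl)
      moreover have "restrict (h \<circ> f) V u \<noteq> restrict (h \<circ> f) V v" if "{u, v} \<in> E" for u v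
      proof
        assume "restrict (h \<circ> f) V u = restrict (h \<circ> f) V v"
        then have "g (h (f u)) = g (h (f v))" using edge[OF that] by simp
        then show False
          using that p PiE_mem[OF f, of u] PiE_mem[OF f, of v] edge[OF that] by (simp add: gh)
      qed
      ultimately show "restrict (h \<circ> f) V \<in> ?B" by blast
    qed
    show "(\<lambda>f. restrict (g \<circ> f) V) ` ?B \<subseteq> ?A"
    proof (rule image_subsetI)
      fix f assume "f \<in> ?B"
      then have f: "f \<in> V \<rightarrow>\<^sub>E {..<card S}" and im: "f ` V = {..<card S}"
        and p: "\<forall>u v. {u, v} \<in> E \<longrightarrow> f u \<noteq> f v" by blast+
      have "restrict (g \<circ> f) V \<in> V \<rightarrow>\<^sub>E S"
        using PiE_mem[OF f] gS by fastforce
      moreover have "restrict (g \<circ> f) V ` V = S"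
        unfolding image_restrict_eq image_comp[symmetric] im gS by (rule refl)
      moreover have "restrict (g \<circ> f) V u \<noteq> restrict (g \<circ> f) V v" if "{u, v} \<in> E" for u v
      proof
        assume "restrict (g \<circ> f) V u = restrict (g \<circ> f) V v"
        then have "h (g (f u)) = h (g (f v))" using edge[OF that] by simp
        then show False
          using that p PiE_mem[OF f, of u] PiE_mem[OF f, of v] edge[OF that] by (simp add: hg)
      qed
      ultimately show "restrict (g \<circ> f) V \<in> ?A" by blast
    qed
  qed
  then show ?thesis by (rule bij_betw_same_card)
qed

lemma ex1_chromatic_polynomial:
  assumes "simple_graph V E"
  shows "\<exists>!p :: real poly. \<forall>q. poly p (of_nat q) = of_nat (card (proper_colourings V E q))"
proof (rule ex_ex1I)
  have V: "finite V" and E: "E \<subseteq> Pow V"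
    using assms by (auto simp: simple_graph_def)
  define C where "C S = {f \<in> V \<rightarrow>\<^sub>E S. f ` V = S \<and> (\<forall>u v. {u, v} \<in> E \<longrightarrow> f u \<noteq> f v)}"
    for S :: "nat set"
  define s where "s k = card (C {..<k})" for k
  define b :: "nat \<Rightarrow> real poly"
    where "b k = smult (1 / fact k) (\<Prod>i<k. [:- of_nat i, 1:])" for k
  have b: "poly (b k) (of_nat q) = of_nat (q choose k)" for k q
    by (simp add: b_def poly_prod binomial_gbinomial gbinomial_prod_rev atLeast0LessThan)
  have s0: "s k = 0" if "k > card V" for k
  proof -
    have "C {..<k} = {}"
    proof (rule ccontr)
      assume "C {..<k} \<noteq> {}"
      then obtain f where "f ` V = {..<k}" by (auto simp: C_def)
      then have "k \<le> card V" using card_image_le[OF V, of f] by simp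
      then show False using that by simp
    qed
    then show ?thesis by (simp add: s_def)
  qed
  have "poly (\<Sum>k\<le>card V. smult (of_nat (s k)) (b k)) (of_nat q) =
        of_nat (card (proper_colourings V E q))" for q
  proof -
    have fin: "finite (C S)" if "finite S" for S
      unfolding C_def by (rule finite_subset[of _ "V \<rightarrow>\<^sub>E S"]) (auto simp: V that finite_PiE)
    have "proper_colourings V E q = (\<Union>S\<in>Pow {..<q}. C S)"
      by (auto simp: proper_colourings_def C_def PiE_def Pi_def)
    then have "card (proper_colourings V E q) = card (\<Union>S\<in>Pow {..<q}. C S)"
      by simp
    also have "\<dots> = (\<Sum>S\<in>Pow {..<q}. card (C S))"
      by (rule card_UN_disjoint) (auto simp: C_def intro!: fin[unfolded C_def] intro: finite_subset)
    also have "\<dots> = (\<Sum>S\<in>Pow {..<q}. s (card S))"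
      unfolding s_def C_def
      by (intro sum.cong refl card_proper_colourings_onto V E) (auto intro: finite_subset)
    also have "\<dots> = (\<Sum>k\<le>q. \<Sum>S\<in>{S \<in> Pow {..<q}. card S = k}. s (card S))"
      by (rule sum.group[symmetric]) (auto dest: card_mono[rotated])
    also have "\<dots> = (\<Sum>k\<le>q. (q choose k) * s k)"
    proof (rule sum.cong[OF refl])
      fix k
      have "(\<Sum>S\<in>{S \<in> Pow {..<q}. card S = k}. s (card S)) =
            (\<Sum>S\<in>{S. S \<subseteq> {..<q} \<and> card S = k}. s k)"
        by (rule sum.cong) auto
      then show "(\<Sum>S\<in>{S \<in> Pow {..<q}. card S = k}. s (card S)) = (q choose k) * s k"
        by (simp add: n_subsets)
    qed
    also have "\<dots> = (\<Sum>k\<le>max q (card V). (q choose k) * s k)"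
      by (rule sum.mono_neutral_left) auto
    also have "\<dots> = (\<Sum>k\<le>card V. (q choose k) * s k)"
      by (rule sum.mono_neutral_right) (auto simp: s0)
    finally show ?thesis
      by (simp add: poly_sum b mult.commute)
  qed
  then show "\<exists>p :: real poly. \<forall>q. poly p (of_nat q) = of_nat (card (proper_colourings V E q))"
    by blast
next
  fix p p' :: "real poly"
  assume p: "\<forall>q. poly p (of_nat q) = of_nat (card (proper_colourings V E q))"
    and p': "\<forall>q. poly p' (of_nat q) = of_nat (card (proper_colourings V E q))"
  show "p = p'"
  proof (rule ccontr)
    assume "p \<noteq> p'"
    then have "finite {x. poly (p - p') x = 0}"
      using poly_roots_finite[of "p - p'"] by simp
    moreover have "range (of_nat :: nat \<Rightarrow> real) \<subseteq> {x. poly (p - p') x = 0}"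
      using p p' by auto
    ultimately have "finite (range (of_nat :: nat \<Rightarrow> real))"
      by (rule finite_subset[rotated])
    then show False
      using finite_imageD[of "of_nat :: nat \<Rightarrow> real" UNIV] by (simp add: inj_of_nat)
  qed
qed


section \<open>Order polytopes\<close>

text \<open>A finite poset is a subset \<open>P\<close> of a finite ordered type, with the induced order; this
  covers the empty poset, which no type provides. The space of real functions on \<open>P\<close> is
  the coordinate subspace of vectors vanishing outside \<open>P\<close>; it is the whole space for
  \<open>P = UNIV\<close>. The Euclidean norm restricts to the Euclidean norm.\<close>

definition function_space :: "'a::finite set \<Rightarrow> (real ^ 'a) set" where
  "function_space P = {x. \<forall>i. i \<notin> P \<longrightarrow> x $ i = 0}"

definition order_polytope :: "'a::{finite,order} set \<Rightarrow> (real, 'a) vec set" where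
  "order_polytope P = {x \<in> function_space P.
     (\<forall>i\<in>P. 0 \<le> x $ i \<and> x $ i \<le> 1) \<and> (\<forall>i\<in>P. \<forall>j\<in>P. i \<le> j \<longrightarrow> x $ i \<le> x $ j)}"


section \<open>Visibility sets\<close>

text \<open>\<open>W\<close> is the ambient space and \<open>S\<close> a polytope whose affine span is \<open>W\<close>, so that the
  boundary of \<open>S\<close> in \<open>W\<close> is \<^term>\<open>rel_frontier S\<close>.\<close>

definition visibility_arrangement :: "'b::euclidean_space set \<Rightarrow> 'b set set" where
  "visibility_arrangement S = {affine hull F | F. F facet_of S}"

definition visible_from :: "'b::euclidean_space set \<Rightarrow> 'b \<Rightarrow> 'b set \<Rightarrow> bool" where
  "visible_from S x F \<longleftrightarrow>
     F facet_of S \<and> (\<forall>y \<in> rel_interior F. closed_segment x y \<inter> rel_frontier S = {y})"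

definition generic_points :: "'b::euclidean_space set \<Rightarrow> 'b set \<Rightarrow> 'b set" where
  "generic_points W S = W - \<Union> (visibility_arrangement S)"

definition visibility_sets :: "'b::euclidean_space set \<Rightarrow> 'b set \<Rightarrow> 'b set set set" where
  "visibility_sets W S = {Collect (visible_from S x) | x. x \<in> generic_points W S}"

definition far_visibility_sets :: "'b::euclidean_space set \<Rightarrow> 'b set \<Rightarrow> 'b set set set" where
  "far_visibility_sets W S =
     {\<V>. \<forall>R. \<exists>x \<in> generic_points W S. norm x \<ge> R \<and> Collect (visible_from S x) = \<V>}"

end

theory Submission
  imports Defs
begin

text \<open>The graph \<open>\<Delta>\<close> is the Hasse diagram of the poset with a bottom and a top element adjoined,
  together with the edge joining these two. Giving the bottom the value 0 and the top the value 1,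
  the facets of the order polytope correspond to the remaining edges, and a generic point orients
  every edge towards the larger value. So visibility sets correspond to the acyclic orientations
  of \<open>\<Delta>\<close> that orient the extra edge upwards, which are half of all acyclic orientations. If
  the bottom is the only source and the top the only sink, then all values lie between 0 and 1;
  otherwise the value of some further source or sink can be moved to infinity. The beta invariant
  counts the orientations of the former kind: the number of proper colourings with \<open>m + 2\<close>
  colours in which two adjacent vertices receive the least and the greatest colour is a
  polynomial in \<open>m\<close> whose value at \<open>- 1\<close> is \<open>\<chi>'(1)\<close>, and summing strict order
  polynomials over the acyclic orientations shows that this value counts bipolar orientations up
  to sign.\<close>

section \<open>Strict order polynomials\<close>

lemma sum_Pow_minus_one_power_card:
  assumes "finite X"
  shows "(\<Sum>A\<in>Pow X. (- 1 :: real) ^ card A) = (if X = {} then 1 else 0)"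
proof -
  have "(\<Sum>A\<in>Pow X. (- 1 :: real) ^ card A) = (\<Prod>x\<in>X. - 1 + 1)"
    using prod_add[OF assms, of "\<lambda>_. - 1 :: real" "\<lambda>_. 1"] by simp
  then show ?thesis using assms by auto
qed

text \<open>Removing \<open>s\<close> from each set turns this into the alternating sum over all
  subsets of \<open>X - {s}\<close>, with the sign changed. For \<open>X\<close> the set of sources
  or of sinks, it detects whether \<open>s\<close> is the only one.\<close>

lemma sum_containing_minus_one_power_card:
  assumes "finite X"
  shows "(\<Sum>A\<in>{A. A \<subseteq> X \<and> s \<in> A}. (- 1 :: real) ^ card A) = (if X = {s} then - 1 else 0)"
proof (cases "s \<in> X")
  case True
  have "(\<Sum>A\<in>{A. A \<subseteq> X \<and> s \<in> A}. (- 1 :: real) ^ card A) =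
        (\<Sum>A\<in>Pow (X - {s}). (- 1) ^ card (insert s A))"
    by (rule sum.reindex_bij_witness[of _ "insert s" "\<lambda>A. A - {s}"])
       (use True in \<open>auto simp: insert_absorb\<close>)
  also have "\<dots> = (\<Sum>A\<in>Pow (X - {s}). - ((- 1) ^ card A))"
  proof (rule sum.cong[OF refl])
    fix A assume A: "A \<in> Pow (X - {s})"
    then have "finite A" "s \<notin> A" using assms by (auto intro: finite_subset)
    then show "(- 1 :: real) ^ card (insert s A) = - ((- 1) ^ card A)" by simp
  qed
  also have "\<dots> = - (if X - {s} = {} then 1 else 0)"
    using sum_Pow_minus_one_power_card[of "X - {s}"] assms by (simp add: sum_negf)
  finally show ?thesis using True by auto
next
  case False
  then have "{A. A \<subseteq> X \<and> s \<in> A} = {}" by auto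
  then show ?thesis using False by (auto simp del: Collect_empty_eq)
qed

text \<open>In the binomial basis the difference operator becomes an index shift. The induction has
  to multiply by \<open>x\<close>, which acts by \<open>x * (x gchoose k) = k * (x gchoose k) + (k +
  1) * (x gchoose (k + 1))\<close>; the last two terms of \<open>d\<close> collect these two
  contributions.\<close>

lemma poly_eq_sum_gbinomial:
  "\<exists>c N. \<forall>x. poly p x = (\<Sum>k\<le>N. c k * (x gchoose k))" for p :: "real poly"
proof (induction p)
  case 0
  show ?case by (intro exI[of _ "\<lambda>_. 0"] exI[of _ 0]) simp
next
  case (pCons a p)
  then obtain c N where p: "poly p x = (\<Sum>k\<le>N. c k * (x gchoose k))" for x by blast
  define d where "d k = (if k = 0 then a else 0) + (if k \<le> N then of_nat k * c k else 0) +
    (if k = 0 then 0 else of_nat k * c (k - 1))" for k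
  have "poly (pCons a p) x = (\<Sum>k\<le>Suc N. d k * (x gchoose k))" for x
  proof -
    have "x * poly p x = (\<Sum>k\<le>N. c k * (x * (x gchoose k)))"
      by (simp add: p sum_distrib_left mult_ac)
    also have "\<dots> = (\<Sum>k\<le>N. of_nat k * c k * (x gchoose k)) +
        (\<Sum>k\<le>N. of_nat (Suc k) * c k * (x gchoose Suc k))"
      by (simp add: gbinomial_mult_1 sum.distrib distrib_left mult_ac)
    also have "(\<Sum>k\<le>N. of_nat (Suc k) * c k * (x gchoose Suc k)) =
        (\<Sum>k\<le>Suc N. (if k = 0 then 0 else of_nat k * c (k - 1)) * (x gchoose k))"
      by (subst sum.atMost_Suc_shift) simp
    also have "(\<Sum>k\<le>N. of_nat k * c k * (x gchoose k)) =
        (\<Sum>k\<le>Suc N. (if k \<le> N then of_nat k * c k else 0) * (x gchoose k))"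
      by simp
    finally have 1: "x * poly p x = (\<Sum>k\<le>Suc N. (if k \<le> N then of_nat k * c k else 0) * (x gchoose k)) +
        (\<Sum>k\<le>Suc N. (if k = 0 then 0 else of_nat k * c (k - 1)) * (x gchoose k))" .
    have 2: "a = (\<Sum>k\<le>Suc N. (if k = 0 then a else 0) * (x gchoose k))"
      by (subst sum.atMost_Suc_shift) simp
    have "poly (pCons a p) x = a + x * poly p x" by simp
    also have "\<dots> = (\<Sum>k\<le>Suc N. d k * (x gchoose k))"
      unfolding d_def distrib_right sum.distrib using 1 2 by linarith
    finally show ?thesis .
  qed
  then show ?case by blast
qed

lemma poly_gbinomial: "poly (smult (1 / fact k) (\<Prod>i<k. [:- of_nat i, 1:])) x = x gchoose k"
  for x :: real
  by (simp add: poly_prod gbinomial_prod_rev atLeast0LessThan)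

text \<open>By Pascal's rule, raising every lower index in the binomial expansion of
  \<open>p\<close> by one gives \<open>s\<close>. The equation holds for all real \<open>x\<close>,
  so that it may later be evaluated at \<open>- 1\<close>.\<close>

lemma poly_indefinite_sum:
  "\<exists>s. \<forall>x. poly s (x + 1) - poly s x = poly p x" for p :: "real poly"
proof -
  obtain c N where p: "poly p x = (\<Sum>k\<le>N. c k * (x gchoose k))" for x
    using poly_eq_sum_gbinomial[of p] by blast
  define b :: "nat \<Rightarrow> real poly"
    where "b k = smult (1 / fact k) (\<Prod>i<k. [:- of_nat i, 1:])" for k
  have b: "poly (b k) x = x gchoose k" for k x
    unfolding b_def by (rule poly_gbinomial)
  have "poly (\<Sum>k\<le>N. smult (c k) (b (Suc k))) (x + 1) - poly (\<Sum>k\<le>N. smult (c k) (b (Suc k))) x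
    = poly p x" for x
    by (simp add: p b poly_sum gbinomial_Suc_Suc sum_subtractf[symmetric] ring_distribs)
  then show ?thesis by blast
qed

text \<open>The colours form an arbitrary set, and only the pairs of \<open>D\<close> inside
  \<open>U\<close> matter. So extreme colours can be split off together with their preimages while
  \<open>D\<close> stays fixed.\<close>

definition strict_maps :: "('v \<times> 'v) set \<Rightarrow> 'v set \<Rightarrow> nat set \<Rightarrow> ('v \<Rightarrow> nat) set" where
  "strict_maps D U I = {f \<in> U \<rightarrow>\<^sub>E I. \<forall>u\<in>U. \<forall>v\<in>U. (u, v) \<in> D \<longrightarrow> f u < f v}"

definition sources :: "('v \<times> 'v) set \<Rightarrow> 'v set \<Rightarrow> 'v set" where
  "sources D U = {v \<in> U. \<forall>u\<in>U. (u, v) \<notin> D}"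

definition sinks :: "('v \<times> 'v) set \<Rightarrow> 'v set \<Rightarrow> 'v set" where
  "sinks D U = {v \<in> U. \<forall>w\<in>U. (v, w) \<notin> D}"

lemma sources_subset: "sources D U \<subseteq> U" and sinks_subset: "sinks D U \<subseteq> U"
  by (auto simp: sources_def sinks_def)

lemma finite_strict_maps: "finite U \<Longrightarrow> finite I \<Longrightarrow> finite (strict_maps D U I)"
  by (rule finite_subset[of _ "U \<rightarrow>\<^sub>E I"]) (auto simp: strict_maps_def finite_PiE)

lemma sources_eq_sinks_converse: "sources D U = sinks (D\<inverse>) U"
  by (auto simp: sources_def sinks_def)

lemma sinks_nonempty:
  assumes "finite U" "U \<noteq> {}" "acyclic D"
  shows "sinks D U \<noteq> {}"
proof -
  define D' where "D' = D \<inter> U \<times> U"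
  have "acyclic D'" using assms(3) by (rule acyclic_subset) (auto simp: D'_def)
  then have "wf (D'\<inverse>)"
    using assms(1) by (intro finite_acyclic_wf_converse) (auto simp: D'_def)
  then obtain z where z: "z \<in> U" "\<And>y. (y, z) \<in> D'\<inverse> \<Longrightarrow> y \<notin> U"
    using wfE_min[of "D'\<inverse>" _ U] assms(2) by (metis ex_in_conv)
  have "(z, w) \<notin> D" if "w \<in> U" for w
    using z(1) z(2)[of w] that by (auto simp: D'_def)
  then show ?thesis using z(1) unfolding sinks_def by blast
qed

lemma sources_nonempty:
  "finite U \<Longrightarrow> U \<noteq> {} \<Longrightarrow> acyclic D \<Longrightarrow> sources D U \<noteq> {}"
  unfolding sources_eq_sinks_converse by (rule sinks_nonempty) simp_all

text \<open>With the values on \<open>K\<close> prescribed, a map is determined by its restriction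
  to \<open>U - K\<close>. Conversely, the conditions on pairs within \<open>K\<close> and between
  \<open>K\<close> and \<open>U - K\<close> ensure that every strict map on \<open>U - K\<close>
  into \<open>I\<close> extends by \<open>g\<close>. Here \<open>K\<close> will be the set of
  vertices with the largest colour, or with one of the two extreme colours.\<close>

lemma card_strict_maps_extending:
  assumes K: "K \<subseteq> U" and J: "g ` K \<subseteq> J" "I \<subseteq> J"
    and KK: "\<And>u v. u \<in> K \<Longrightarrow> v \<in> K \<Longrightarrow> (u, v) \<in> D \<Longrightarrow> g u < g v"
    and KI: "\<And>u v i. u \<in> K \<Longrightarrow> v \<in> U - K \<Longrightarrow> (u, v) \<in> D \<Longrightarrow> i \<in> I \<Longrightarrow> g u < i"
    and IK: "\<And>u v i. u \<in> U - K \<Longrightarrow> v \<in> K \<Longrightarrow> (u, v) \<in> D \<Longrightarrow> i \<in> I \<Longrightarrow> i < g v"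
  shows "card {f \<in> strict_maps D U J. (\<forall>v\<in>K. f v = g v) \<and> f ` (U - K) \<subseteq> I} =
         card (strict_maps D (U - K) I)" (is "card ?A = card ?B")
proof (rule bij_betw_same_card)
  show "bij_betw (\<lambda>f. restrict f (U - K)) ?A ?B"
  proof (rule bij_betw_byWitness[where f' = "\<lambda>f v. if v \<in> K then g v else f v"])
    show "\<forall>f\<in>?A. (\<lambda>v. if v \<in> K then g v else restrict f (U - K) v) = f"
    proof
      fix f assume f: "f \<in> ?A"
      then have "f v = undefined" if "v \<notin> U" for v
        using that by (auto simp: strict_maps_def dest: PiE_arb)
      then show "(\<lambda>v. if v \<in> K then g v else restrict f (U - K) v) = f"
        using f by (intro ext) (simp add: restrict_def)
    qed
    show "\<forall>f\<in>?B. restrict (\<lambda>v. if v \<in> K then g v else f v) (U - K) = f"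
    proof
      fix f assume "f \<in> ?B"
      then have "f v = undefined" if "v \<notin> U - K" for v
        using that by (auto simp: strict_maps_def dest: PiE_arb)
      then show "restrict (\<lambda>v. if v \<in> K then g v else f v) (U - K) = f"
        by (intro ext) (simp add: restrict_def)
    qed
    show "(\<lambda>f. restrict f (U - K)) ` ?A \<subseteq> ?B"
      by (simp add: strict_maps_def image_subset_iff)
    show "(\<lambda>f v. if v \<in> K then g v else f v) ` ?B \<subseteq> ?A"
    proof (rule image_subsetI)
      fix f assume f: "f \<in> ?B"
      then have fI: "f \<in> (U - K) \<rightarrow>\<^sub>E I" by (simp add: strict_maps_def)
      have fv: "f v \<in> I" if "v \<in> U - K" for v
        using fI that by (rule PiE_mem)
      have "f u < f v" if "u \<in> U - K" "v \<in> U - K" "(u, v) \<in> D" for u v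
        using f that by (simp add: strict_maps_def)
      then have "(if u \<in> K then g u else f u) < (if v \<in> K then g v else f v)"
        if "u \<in> U" "v \<in> U" "(u, v) \<in> D" for u v
        using that KK[of u v] KI[of u v "f v"] IK[of u v "f u"] fv[of u] fv[of v] by simp
      moreover have "(\<lambda>v. if v \<in> K then g v else f v) \<in> U \<rightarrow>\<^sub>E J"
      proof (rule PiE_I)
        show "(if v \<in> K then g v else f v) \<in> J" if "v \<in> U" for v
          using that fv[of v] J by auto
        show "(if v \<in> K then g v else f v) = undefined" if "v \<notin> U" for v
          using that K fI by (auto dest: PiE_arb)
      qed
      ultimately show "(\<lambda>v. if v \<in> K then g v else f v) \<in> ?A"
        using fv by (simp add: strict_maps_def image_subset_iff)
    qed
  qed
qed

text \<open>Sort the maps by the preimage \<open>A\<close> of \<open>a\<close>. No value exceeds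
  \<open>a\<close>, so \<open>A\<close> consists of sinks; conversely, any set of sinks can receive
  \<open>a\<close>, whatever strict map into \<open>I\<close> is chosen on the rest.\<close>

lemma card_strict_maps_insert_max:
  assumes U: "finite U" and I: "finite I" and a: "\<And>i. i \<in> I \<Longrightarrow> i < a"
  shows "card (strict_maps D U (insert a I)) =
         (\<Sum>A\<in>Pow (sinks D U). card (strict_maps D (U - A) I))"
proof -
  define F where "F A = {f \<in> strict_maps D U (insert a I). {v \<in> U. f v = a} = A}" for A
  have fin: "finite (strict_maps D U (insert a I))"
    using U I by (simp add: finite_strict_maps)
  have "strict_maps D U (insert a I) \<subseteq> (\<Union>A\<in>Pow (sinks D U). F A)"
  proof
    fix f assume f: "f \<in> strict_maps D U (insert a I)"
    then have "f w \<le> a" if "w \<in> U" for w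
      using a that by (force simp: strict_maps_def PiE_def Pi_def)
    then have "{v \<in> U. f v = a} \<subseteq> sinks D U"
      using f by (force simp: strict_maps_def sinks_def)
    then show "f \<in> (\<Union>A\<in>Pow (sinks D U). F A)"
      using f by (auto simp: F_def)
  qed
  then have "strict_maps D U (insert a I) = (\<Union>A\<in>Pow (sinks D U). F A)"
    by (auto simp: F_def)
  then have "card (strict_maps D U (insert a I)) = card (\<Union>A\<in>Pow (sinks D U). F A)"
    by simp
  also have "\<dots> = (\<Sum>A\<in>Pow (sinks D U). card (F A))"
    by (rule card_UN_disjoint)
       (use fin U in \<open>auto simp: F_def intro: finite_subset[OF sinks_subset]\<close>)
  also have "\<dots> = (\<Sum>A\<in>Pow (sinks D U). card (strict_maps D (U - A) I))"
  proof (rule sum.cong[OF refl])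
    fix A assume A: "A \<in> Pow (sinks D U)"
    then have AU: "A \<subseteq> U" using sinks_subset[of D U] by blast
    have no: "(u, v) \<notin> D" if "u \<in> A" "v \<in> U" for u v
      using A that by (auto simp: sinks_def)
    have "F A = {f \<in> strict_maps D U (insert a I). (\<forall>v\<in>A. f v = a) \<and> f ` (U - A) \<subseteq> I}"
      using AU a by (fastforce simp: F_def strict_maps_def)
    also have "card \<dots> = card (strict_maps D (U - A) I)"
      by (rule card_strict_maps_extending) (use AU no a in auto)
    finally show "card (F A) = card (strict_maps D (U - A) I)" .
  qed
  finally show ?thesis .
qed

lemma strict_maps_empty: "card (strict_maps D U {}) = (if U = {} then 1 else 0)"
proof -
  have "strict_maps D U {} = (if U = {} then {\<lambda>_. undefined} else {})"
    by (auto simp: strict_maps_def)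
  then show ?thesis by simp
qed

text \<open>Splitting off the preimage of the largest colour, the polynomials \<open>p\<^sub>U\<close> satisfy
  \<open>p\<^sub>U (x + 1) = (\<Sum>A \<subseteq> sinks D U. p\<^sub>U\<^sub>-\<^sub>A (x))\<close>. For \<open>x = - 1\<close> and \<open>U\<close> nonempty the left side vanishes,
  which determines \<open>p\<^sub>U (- 1)\<close> by induction. This is an instance of Stanley's reciprocity.\<close>

lemma strict_maps_polynomial:
  assumes "finite U" "acyclic D"
  shows "\<exists>p :: real poly. (\<forall>I. finite I \<longrightarrow> poly p (of_nat (card I)) = of_nat (card (strict_maps D U I))) \<and>
           poly p (- 1) = (- 1) ^ card U"
  using assms(1)
proof (induction U rule: finite_psubset_induct)
  case (psubset U)
  show ?case
  proof (cases "U = {}")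
    case True
    have "strict_maps D {} I = {\<lambda>_. undefined}" for I
      by (auto simp: strict_maps_def)
    then show ?thesis using True by (intro exI[of _ 1]) simp
  next
    case False
    \<comment> \<open>The term for the empty set of sinks is the polynomial of \<open>U\<close>
      itself. Separating it leaves a difference equation whose right side is known by
      induction.\<close>
    define \<A> where "\<A> = Pow (sinks D U) - {{}}"
    have fS: "finite (sinks D U)"
      using psubset.hyps sinks_subset finite_subset by metis
    have f\<A>: "finite \<A>" using fS by (simp add: \<A>_def)
    have "\<forall>A\<in>\<A>. \<exists>p :: real poly. (\<forall>I. finite I \<longrightarrow>
        poly p (of_nat (card I)) = of_nat (card (strict_maps D (U - A) I))) \<and>
        poly p (- 1) = (- 1) ^ card (U - A)"
      by (intro ballI psubset.IH) (use sinks_subset[of D U] in \<open>auto simp: \<A>_def\<close>)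
    then obtain p where p: "\<And>A I. A \<in> \<A> \<Longrightarrow> finite I \<Longrightarrow>
          poly (p A) (of_nat (card I)) = of_nat (card (strict_maps D (U - A) I))"
      and p1: "\<And>A. A \<in> \<A> \<Longrightarrow> poly (p A) (- 1 :: real) = (- 1) ^ card (U - A)"
      by metis
    obtain s where s: "poly s (x + 1) - poly s x = poly (\<Sum>A\<in>\<A>. p A) x" for x
      using poly_indefinite_sum by blast
    \<comment> \<open>The additive constant is fixed by the value at 0: a nonempty \<open>U\<close>
      has no map into the empty set of colours.\<close>
    define r where "r = s - [:poly s 0:]"
    have r: "poly r (x + 1) = poly r x + (\<Sum>A\<in>\<A>. poly (p A) x)" for x
      using s[of x] by (simp add: r_def poly_sum)
    have r0: "poly r 0 = 0" by (simp add: r_def)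
    have count: "poly r (of_nat (card I)) = of_nat (card (strict_maps D U I))" if "finite I" for I
      using that
    proof (induction I rule: finite_linorder_max_induct)
      case empty
      show ?case using False by (simp add: r0 strict_maps_empty)
    next
      case (insert b I)
      then have b: "b \<notin> I" by blast
      have "card (strict_maps D U (insert b I)) =
            (\<Sum>A\<in>Pow (sinks D U). card (strict_maps D (U - A) I))"
        by (rule card_strict_maps_insert_max) (use insert psubset in auto)
      also have "\<dots> = card (strict_maps D U I) + (\<Sum>A\<in>\<A>. card (strict_maps D (U - A) I))"
        unfolding \<A>_def using fS by (subst sum.remove[of _ "{}"]) auto
      finally show ?case
        using r[of "of_nat (card I)"] b insert by (simp add: p add.commute)
    qed
    have "A \<subseteq> U \<and> finite A" if "A \<in> \<A>" for A
      using that fS sinks_subset[of D U] by (auto simp: \<A>_def intro: finite_subset)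
    then have cU: "card A \<le> card U" and cA: "card (U - A) = card U - card A" if "A \<in> \<A>" for A
      using that psubset.hyps by (auto intro: card_mono card_Diff_subset)
    have "poly (p A) (- 1) = (- 1) ^ card U * (- 1) ^ card A" if "A \<in> \<A>" for A
      using that cU[OF that] by (auto simp: p1 cA minus_one_power_iff)
    then have "(\<Sum>A\<in>\<A>. poly (p A) (- 1)) = (- 1) ^ card U * (\<Sum>A\<in>\<A>. (- 1) ^ card A)"
      by (simp add: sum_distrib_left)
    \<comment> \<open>Over all sets of sinks the alternating sum is 0, since a nonempty acyclic
      \<open>U\<close> has a sink. The omitted empty set accounts for 1.\<close>
    also have "(\<Sum>A\<in>\<A>. (- 1) ^ card A) = (- 1 :: real)"
    proof -
      have "(\<Sum>A\<in>Pow (sinks D U). (- 1 :: real) ^ card A) = 0"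
        using sum_Pow_minus_one_power_card[OF fS] sinks_nonempty[OF psubset.hyps False assms(2)]
        by simp
      moreover have "(\<Sum>A\<in>Pow (sinks D U). (- 1 :: real) ^ card A) = 1 + (\<Sum>A\<in>\<A>. (- 1) ^ card A)"
        unfolding \<A>_def using fS by (subst sum.remove[of _ "{}"]) auto
      ultimately show ?thesis by simp
    qed
    finally have "poly r (- 1) = (- 1) ^ card U"
      using r[of "- 1"] r0 by simp
    then show ?thesis using count by blast
  qed
qed

section \<open>Bipolar orientations and the beta invariant\<close>

lemma finite_orientations:
  assumes "simple_graph V E"
  shows "finite (orientations E)"
proof (rule finite_subset)
  show "orientations E \<subseteq> Pow (V \<times> V)"
    using assms by (auto simp: orientations_def simple_graph_def)
  show "finite (Pow (V \<times> V))" using assms by (simp add: simple_graph_def)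
qed

lemma orientations_converse:
  assumes D: "D \<in> orientations E"
  shows "D\<inverse> \<in> orientations E"
proof -
  have "{u, v} \<in> E" if "(v, u) \<in> D" for u v
    using D that unfolding orientations_def by (subst insert_commute) blast
  moreover have "(v, u) \<in> D \<longleftrightarrow> (u, v) \<notin> D" if "{u, v} \<in> E" for u v
    using D that unfolding orientations_def by blast
  ultimately show ?thesis unfolding orientations_def by blast
qed

text \<open>Reversing all arrows preserves acyclicity and exchanges the two directions of the edge
  between \<open>s\<close> and \<open>t\<close>.\<close>

lemma num_acyclic_orientations_eq_twice:
  assumes G: "simple_graph V E" and e: "{s, t} \<in> E"
  shows "num_acyclic_orientations E = 2 * card {D \<in> orientations E. acyclic D \<and> (s, t) \<in> D}"
proof -
  define A where "A = {D \<in> orientations E. acyclic D \<and> (s, t) \<in> D}"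
  define B where "B = {D \<in> orientations E. acyclic D \<and> (t, s) \<in> D}"
  have fin: "finite A" "finite B"
    using finite_orientations[OF G] by (simp_all add: A_def B_def)
  have iff: "(s, t) \<in> D \<longleftrightarrow> (t, s) \<notin> D" if "D \<in> orientations E" for D
    using that e by (simp add: orientations_def)
  have "bij_betw converse A B"
    by (rule bij_betw_byWitness[where f' = converse])
       (auto simp: A_def B_def orientations_converse)
  then have "card B = card A" by (simp add: bij_betw_same_card)
  moreover have "{D \<in> orientations E. acyclic D} = A \<union> B" and "A \<inter> B = {}"
    using iff by (auto simp: A_def B_def)
  ultimately show ?thesis
    using card_Un_disjoint[OF fin] by (simp add: num_acyclic_orientations_def A_def)
qed

section \<open>Colourings with prescribed colours at the ends of an edge\<close>

lemma finite_proper_colourings: "finite V \<Longrightarrow> finite (proper_colourings V E q)"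
  by (rule finite_subset[of _ "V \<rightarrow>\<^sub>E {..<q}"]) (auto simp: proper_colourings_def finite_PiE)

text \<open>Permuting the colours preserves properness. Used in both directions, the inequality
  becomes an equality.\<close>

lemma card_proper_colourings_two_fixed_le:
  assumes G: "simple_graph V E" and st: "s \<in> V" "t \<in> V"
    and ab: "a < q" "b < q" "a \<noteq> b" and cd: "c < q" "d < q" "c \<noteq> d"
  shows "card {f \<in> proper_colourings V E q. f s = a \<and> f t = b} \<le>
         card {f \<in> proper_colourings V E q. f s = c \<and> f t = d}" (is "card ?A \<le> card ?B")
proof (rule card_inj_on_le)
  \<comment> \<open>The inner transposition takes \<open>a\<close> to \<open>c\<close> and
    \<open>b\<close> to some colour other than \<open>c\<close>. The outer one moves that colour to
    \<open>d\<close> and fixes \<open>c\<close>.\<close>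
  define p where "p = Transposition.transpose (Transposition.transpose a c b) d \<circ>
      Transposition.transpose a c"
  have inj: "inj p" unfolding p_def by (intro inj_compose) simp_all
  have pa: "p a = c" and pb: "p b = d"
    using ab(3) cd(3) by (auto simp: p_def Transposition.transpose_def)
  have less: "p i < q" if "i < q" for i
    using ab cd that by (simp add: p_def Transposition.transpose_def)
  have edge: "u \<in> V \<and> v \<in> V" if "{u, v} \<in> E" for u v
    using G that by (auto simp: simple_graph_def)
  show "inj_on (\<lambda>f. restrict (p \<circ> f) V) ?A"
  proof (rule inj_onI)
    fix f g assume f: "f \<in> ?A" and g: "g \<in> ?A"
      and eq: "restrict (p \<circ> f) V = restrict (p \<circ> g) V"
    have "f v = g v" if "v \<in> V" for v
      using fun_cong[OF eq, of v] that injD[OF inj] by auto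
    then show "f = g"
      using f g by (auto simp: proper_colourings_def intro: PiE_ext)
  qed
  show "(\<lambda>f. restrict (p \<circ> f) V) ` ?A \<subseteq> ?B"
  proof (rule image_subsetI)
    fix f assume f: "f \<in> ?A"
    then have "restrict (p \<circ> f) V \<in> V \<rightarrow>\<^sub>E {..<q}"
      using less by (auto simp: proper_colourings_def dest!: PiE_mem)
    moreover have "restrict (p \<circ> f) V u \<noteq> restrict (p \<circ> f) V v" if "{u, v} \<in> E" for u v
      using f that edge[OF that] by (simp add: proper_colourings_def inj_eq[OF inj])
    ultimately show "restrict (p \<circ> f) V \<in> ?B"
      using f st pa pb by (auto simp: proper_colourings_def)
  qed
  show "finite ?B"
    using G by (auto simp: simple_graph_def intro: finite_subset[OF _ finite_proper_colourings])
qed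

text \<open>The ends of an edge receive one of \<open>(m + 2) * (m + 1)\<close> ordered pairs of
  distinct colours, and all these pairs occur equally often. The pair \<open>(0, m + 1)\<close>
  represents them because extreme colours only fit sources and sinks.\<close>

lemma card_proper_colourings_two_fixed:
  assumes G: "simple_graph V E" and e: "{s, t} \<in> E"
  shows "card (proper_colourings V E (m + 2)) =
         (m + 2) * (m + 1) * card {f \<in> proper_colourings V E (m + 2). f s = 0 \<and> f t = m + 1}"
proof -
  have V: "finite V" and st: "s \<in> V" "t \<in> V"
    using G e by (auto simp: simple_graph_def)
  define F where "F = (\<lambda>(a, b). {f \<in> proper_colourings V E (m + 2). f s = a \<and> f t = b})"
  define X where "X = (SIGMA a:{..<m + 2}. {..<m + 2} - {a})"
  have fX: "finite X" by (simp add: X_def)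
  have "card X = (m + 2) * (m + 1)"
    unfolding X_def by (subst card_SigmaI) auto
  have "proper_colourings V E (m + 2) \<subseteq> (\<Union>x\<in>X. F x)"
  proof
    fix f assume f: "f \<in> proper_colourings V E (m + 2)"
    then have "f s \<noteq> f t" using e by (simp add: proper_colourings_def)
    then have "(f s, f t) \<in> X"
      using f st by (auto simp: X_def proper_colourings_def PiE_def Pi_def)
    then show "f \<in> (\<Union>x\<in>X. F x)"
      using f by (force simp: F_def)
  qed
  then have "proper_colourings V E (m + 2) = (\<Union>x\<in>X. F x)"
    by (auto simp: F_def)
  then have "card (proper_colourings V E (m + 2)) = card (\<Union>x\<in>X. F x)" by simp
  also have "\<dots> = (\<Sum>x\<in>X. card (F x))"
    by (rule card_UN_disjoint) (use fX finite_proper_colourings[OF V] in \<open>auto simp: F_def\<close>)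
  also have "\<dots> = (\<Sum>x\<in>X. card (F (0, m + 1)))"
    unfolding F_def
    by (intro sum.cong refl)
       (auto simp: X_def intro!: antisym card_proper_colourings_two_fixed_le[OF G st])
  also have "\<dots> = (m + 2) * (m + 1) * card (F (0, m + 1))"
    using \<open>card X = (m + 2) * (m + 1)\<close> by simp
  finally show ?thesis by (simp add: F_def)
qed

section \<open>Proper colourings sorted by acyclic orientations\<close>

lemma proper_colouring_orientation:
  assumes f: "f \<in> proper_colourings V E q"
  shows "{(u, v). {u, v} \<in> E \<and> f u < f v} \<in> {D \<in> orientations E. acyclic D}"
proof -
  have "f u \<noteq> f v" if "{u, v} \<in> E" for u v
    using f that by (simp add: proper_colourings_def)
  then have "{(u, v). {u, v} \<in> E \<and> f u < f v} \<in> orientations E"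
    by (auto simp: orientations_def insert_commute not_less less_le)
  moreover have "acyclic (inv_image less_than f)"
    by (intro wf_acyclic wf_inv_image wf_less_than)
  then have "acyclic {(u, v). {u, v} \<in> E \<and> f u < f v}"
    by (rule acyclic_subset) (auto simp: inv_image_def)
  ultimately show ?thesis by blast
qed

text \<open>An orientation contains every edge in exactly one direction, so a map that increases
  strictly along \<open>D\<close> determines \<open>D\<close>. Thus the strict maps of the acyclic
  orientations partition the proper colourings.\<close>

lemma strict_maps_orientation:
  assumes G: "simple_graph V E" and D: "D \<in> orientations E"
  shows "f \<in> strict_maps D V {..<q} \<longleftrightarrow>
         f \<in> proper_colourings V E q \<and> D = {(u, v). {u, v} \<in> E \<and> f u < f v}"
proof -
  have edge: "u \<in> V \<and> v \<in> V" if "{u, v} \<in> E" for u v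
    using G that by (auto simp: simple_graph_def)
  have D1: "{u, v} \<in> E" if "(u, v) \<in> D" for u v
    using D that by (auto simp: orientations_def)
  have D2: "(u, v) \<in> D \<or> (v, u) \<in> D" if "{u, v} \<in> E" for u v
    using D that by (auto simp: orientations_def)
  show ?thesis
  proof
    assume f: "f \<in> strict_maps D V {..<q}"
    then have less: "f u < f v" if "(u, v) \<in> D" for u v
      using edge[OF D1[OF that]] that by (auto simp: strict_maps_def)
    have "f u \<noteq> f v" if "{u, v} \<in> E" for u v
      using D2[OF that] less[of u v] less[of v u] by auto
    then have "f \<in> proper_colourings V E q"
      using f by (auto simp: strict_maps_def proper_colourings_def)
    moreover have "(u, v) \<in> D \<longleftrightarrow> {u, v} \<in> E \<and> f u < f v" for u v
      using D1[of u v] D2[of u v] less[of u v] less[of v u] by auto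
    ultimately show "f \<in> proper_colourings V E q \<and> D = {(u, v). {u, v} \<in> E \<and> f u < f v}"
      by auto
  next
    assume "f \<in> proper_colourings V E q \<and> D = {(u, v). {u, v} \<in> E \<and> f u < f v}"
    then show "f \<in> strict_maps D V {..<q}"
      by (simp add: strict_maps_def proper_colourings_def)
  qed
qed

text \<open>Sort the maps by the preimages \<open>A\<close> of 0 and \<open>B\<close> of
  \<open>m + 1\<close>, which consist of sources and of sinks. As no vertex is both,
  \<open>A\<close> and \<open>B\<close> can be chosen independently, and the other vertices use the
  \<open>m\<close> colours in between.\<close>

lemma card_strict_maps_extremes_fixed:
  assumes V: "finite V" and disj: "sources D V \<inter> sinks D V = {}" and st: "s \<in> V" "t \<in> V"
  shows "card {f \<in> strict_maps D V {..<m + 2}. f s = 0 \<and> f t = m + 1} =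
    (\<Sum>(A, B) \<in> {A. A \<subseteq> sources D V \<and> s \<in> A} \<times> {B. B \<subseteq> sinks D V \<and> t \<in> B}.
       card (strict_maps D (V - (A \<union> B)) {1..m}))"
proof -
  define X where "X = {A. A \<subseteq> sources D V \<and> s \<in> A} \<times> {B. B \<subseteq> sinks D V \<and> t \<in> B}"
  define F where "F = (\<lambda>(A, B). {f \<in> strict_maps D V {..<m + 2}.
      {v \<in> V. f v = 0} = A \<and> {v \<in> V. f v = m + 1} = B})"
  have fX: "finite X"
    unfolding X_def using V by (simp add: sources_def sinks_def)
  have "f \<in> (\<Union>x\<in>X. F x)"
    if f: "f \<in> strict_maps D V {..<m + 2}" "f s = 0" "f t = m + 1" for f
  proof -
    have le: "f v < m + 2" if "v \<in> V" for v
      using f(1) that by (auto simp: strict_maps_def)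
    have less: "f u < f v" if "u \<in> V" "v \<in> V" "(u, v) \<in> D" for u v
      using f(1) that by (simp add: strict_maps_def)
    have "v \<in> sources D V" if "v \<in> V" "f v = 0" for v
      using that less[of _ v] by (auto simp: sources_def)
    moreover have "v \<in> sinks D V" if "v \<in> V" "f v = m + 1" for v
      using that less[of v] le by (force simp: sinks_def)
    ultimately have "({v \<in> V. f v = 0}, {v \<in> V. f v = m + 1}) \<in> X"
      using f st by (auto simp: X_def)
    then show ?thesis by (rule UN_I) (use f(1) in \<open>simp add: F_def\<close>)
  qed
  then have "{f \<in> strict_maps D V {..<m + 2}. f s = 0 \<and> f t = m + 1} = (\<Union>x\<in>X. F x)"
    by (auto simp: F_def X_def)
  then have "card {f \<in> strict_maps D V {..<m + 2}. f s = 0 \<and> f t = m + 1} = card (\<Union>x\<in>X. F x)"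
    by simp
  also have "\<dots> = (\<Sum>x\<in>X. card (F x))"
    by (rule card_UN_disjoint)
       (use fX finite_strict_maps[OF V, of "{..<m + 2}"] in \<open>auto simp: F_def\<close>)
  also have "\<dots> = (\<Sum>(A, B)\<in>X. card (strict_maps D (V - (A \<union> B)) {1..m}))"
  proof (intro sum.cong refl, clarify)
    fix A B assume "(A, B) \<in> X"
    then have AB: "A \<subseteq> sources D V" "B \<subseteq> sinks D V" by (auto simp: X_def)
    then have "A \<inter> B = {}" using disj by blast
    have AV: "A \<union> B \<subseteq> V" using AB sources_subset[of D V] sinks_subset[of D V] by blast
    have noA: "(u, v) \<notin> D" if "v \<in> A" "u \<in> V" for u v
      using AB that by (auto simp: sources_def)
    have noB: "(u, v) \<notin> D" if "u \<in> B" "v \<in> V" for u v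
      using AB that by (auto simp: sinks_def)
    define g where "g v = (if v \<in> A then 0 else m + 1)" for v
    have "f \<in> F (A, B) \<longleftrightarrow> f \<in> strict_maps D V {..<m + 2} \<and> (\<forall>v\<in>A \<union> B. f v = g v) \<and>
        f ` (V - (A \<union> B)) \<subseteq> {1..m}" for f
    proof (cases "f \<in> strict_maps D V {..<m + 2}")
      case True
      then have range: "f v < m + 2" if "v \<in> V" for v
        using that by (auto simp: strict_maps_def)
      have "f \<in> F (A, B) \<longleftrightarrow> (\<forall>v\<in>V. (v \<in> A \<longleftrightarrow> f v = 0) \<and> (v \<in> B \<longleftrightarrow> f v = m + 1))"
        using True AV by (auto simp: F_def)
      also have "\<dots> \<longleftrightarrow> (\<forall>v\<in>V. if v \<in> A \<union> B then f v = g v else f v \<in> {1..m})"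
      proof (rule ball_cong[OF refl])
        fix v assume "v \<in> V"
        then have "f v = 0 \<or> f v \<in> {1..m} \<or> f v = m + 1" using range[of v] by auto
        then show "(v \<in> A \<longleftrightarrow> f v = 0) \<and> (v \<in> B \<longleftrightarrow> f v = m + 1) \<longleftrightarrow>
            (if v \<in> A \<union> B then f v = g v else f v \<in> {1..m})"
          using \<open>A \<inter> B = {}\<close> by (auto simp: g_def)
      qed
      also have "\<dots> \<longleftrightarrow> (\<forall>v\<in>A \<union> B. f v = g v) \<and> f ` (V - (A \<union> B)) \<subseteq> {1..m}"
        using AV unfolding image_subset_iff by (auto split: if_splits)
      finally show ?thesis using True by simp
    next
      case False
      then show ?thesis by (simp add: F_def)
    qed
    then have "F (A, B) = {f \<in> strict_maps D V {..<m + 2}. (\<forall>v\<in>A \<union> B. f v = g v) \<and>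
        f ` (V - (A \<union> B)) \<subseteq> {1..m}}" by blast
    also have "card \<dots> = card (strict_maps D (V - (A \<union> B)) {1..m})"
    proof (rule card_strict_maps_extending[OF AV])
      show "g ` (A \<union> B) \<subseteq> {..<m + 2}" by (auto simp: g_def)
      show "{1..m} \<subseteq> {..<m + 2}" by auto
      show "g u < g v" if "u \<in> A \<union> B" "v \<in> A \<union> B" "(u, v) \<in> D" for u v
        using that noA noB AV by (auto simp: g_def)
      show "g u < i" if "u \<in> A \<union> B" "v \<in> V - (A \<union> B)" "(u, v) \<in> D" "i \<in> {1..m}" for u v i
        using that noB by (auto simp: g_def)
      show "i < g v" if "u \<in> V - (A \<union> B)" "v \<in> A \<union> B" "(u, v) \<in> D" "i \<in> {1..m}" for u v i
        using that noA by (auto simp: g_def)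
    qed
    finally show "card (F (A, B)) = card (strict_maps D (V - (A \<union> B)) {1..m})" .
  qed
  finally show ?thesis by (simp add: X_def)
qed

text \<open>At \<open>- 1\<close> the summand for \<open>A\<close> and \<open>B\<close> is
  \<open>- 1\<close> to the power \<open>card V - card A - card B\<close>. So the double sum factors
  into alternating sums over sets of sources containing \<open>s\<close> and sets of sinks
  containing \<open>t\<close>. Each of them is \<open>- 1\<close> or 0, according to whether the
  source or sink is unique.\<close>

lemma strict_maps_extremes_fixed_polynomial:
  assumes V: "finite V" and D: "acyclic D" and disj: "sources D V \<inter> sinks D V = {}"
    and st: "s \<in> V" "t \<in> V"
  shows "\<exists>p :: real poly.
    (\<forall>m. poly p (of_nat m) = of_nat (card {f \<in> strict_maps D V {..<m + 2}. f s = 0 \<and> f t = m + 1})) \<and>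
    poly p (- 1) = (- 1) ^ card V * (if sources D V = {s} \<and> sinks D V = {t} then 1 else 0)"
proof -
  define \<A> where "\<A> = {A. A \<subseteq> sources D V \<and> s \<in> A}"
  define \<B> where "\<B> = {B. B \<subseteq> sinks D V \<and> t \<in> B}"
  have fin: "finite (sources D V)" "finite (sinks D V)"
    using V by (simp_all add: sources_def sinks_def)
  have "\<forall>U\<in>Pow V. \<exists>p :: real poly. (\<forall>I. finite I \<longrightarrow> poly p (of_nat (card I)) =
      of_nat (card (strict_maps D U I))) \<and> poly p (- 1) = (- 1) ^ card U"
    using V by (intro ballI strict_maps_polynomial D) (auto intro: finite_subset)
  then obtain p where p: "\<And>U I. U \<subseteq> V \<Longrightarrow> finite I \<Longrightarrow> poly (p U) (of_nat (card I)) =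
      of_nat (card (strict_maps D U I))" and p1: "\<And>U. U \<subseteq> V \<Longrightarrow> poly (p U) (- 1 :: real) = (- 1) ^ card U"
    by (metis PowI)
  define r where "r = (\<Sum>(A, B)\<in>\<A> \<times> \<B>. p (V - (A \<union> B)))"
  have "poly r (of_nat m) = of_nat (card {f \<in> strict_maps D V {..<m + 2}. f s = 0 \<and> f t = m + 1})" for m
  proof -
    have "poly (p (V - (A \<union> B))) (of_nat m) = of_nat (card (strict_maps D (V - (A \<union> B)) {1..m}))" for A B
      using p[of "V - (A \<union> B)" "{1..m}"] by simp
    then show ?thesis
      unfolding card_strict_maps_extremes_fixed[OF V disj st] r_def \<A>_def[symmetric] \<B>_def[symmetric]
      by (simp add: poly_sum case_prod_unfold)
  qed
  moreover have "poly r (- 1) = (- 1) ^ card V * (if sources D V = {s} \<and> sinks D V = {t} then 1 else 0)"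
  proof -
    have "poly r (- 1) = (\<Sum>(A, B)\<in>\<A> \<times> \<B>. (- 1) ^ card V * ((- 1) ^ card A * (- 1) ^ card B))"
      unfolding r_def poly_sum
    proof (intro sum.cong refl, clarify)
      fix A B assume "A \<in> \<A>" "B \<in> \<B>"
      then have AB: "A \<subseteq> sources D V" "B \<subseteq> sinks D V" by (auto simp: \<A>_def \<B>_def)
      then have f: "finite A" "finite B" and d: "A \<inter> B = {}" and sub: "A \<union> B \<subseteq> V"
        using fin disj sources_subset[of D V] sinks_subset[of D V] by (auto intro: finite_subset)
      have le: "card (A \<union> B) \<le> card V" using V sub by (rule card_mono)
      have "card (V - (A \<union> B)) = card V - card (A \<union> B)"
        using f sub by (intro card_Diff_subset) auto
      moreover have "card (A \<union> B) = card A + card B" using f d by (rule card_Un_disjoint)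
      ultimately show "poly (p (V - (A \<union> B))) (- 1) = (- 1) ^ card V * ((- 1) ^ card A * (- 1) ^ card B)"
        using le by (auto simp: p1 minus_one_power_iff)
    qed
    also have "\<dots> = (- 1) ^ card V * ((\<Sum>A\<in>\<A>. (- 1) ^ card A) * (\<Sum>B\<in>\<B>. (- 1) ^ card B))"
      by (subst sum_product) (simp add: sum_distrib_left sum.cartesian_product case_prod_unfold)
    also have "(\<Sum>A\<in>\<A>. (- 1 :: real) ^ card A) = (if sources D V = {s} then - 1 else 0)"
      unfolding \<A>_def by (rule sum_containing_minus_one_power_card[OF fin(1)])
    also have "(\<Sum>B\<in>\<B>. (- 1 :: real) ^ card B) = (if sinks D V = {t} then - 1 else 0)"
      unfolding \<B>_def by (rule sum_containing_minus_one_power_card[OF fin(2)])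
    finally show ?thesis by simp
  qed
  ultimately show ?thesis by blast
qed

text \<open>A vertex that is both a source and a sink would be isolated, but the graph is connected
  and has an edge.\<close>

lemma connected_sources_sinks_disjoint:
  assumes conn: "connected_graph V E" and D: "D \<in> orientations E" and G: "simple_graph V E"
    and e: "{s, t} \<in> E"
  shows "sources D V \<inter> sinks D V = {}"
proof -
  have edge: "u \<in> V \<and> v \<in> V" if "{u, v} \<in> E" for u v
    using G that by (auto simp: simple_graph_def)
  have st: "s \<in> V" "t \<in> V" "s \<noteq> t" using G e by (auto simp: simple_graph_def)
  have "\<exists>w. {v, w} \<in> E" if "v \<in> V" for v
  proof -
    obtain x where x: "x \<in> V" "x \<noteq> v" using st by metis
    then have "(v, x) \<in> {(a, b). {a, b} \<in> E}\<^sup>*"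
      using conn that by (simp add: connected_graph_def)
    then show ?thesis using x(2) by (cases rule: converse_rtranclE) auto
  qed
  then have "\<exists>w\<in>V. (v, w) \<in> D \<or> (w, v) \<in> D" if "v \<in> V" for v
    using D that edge unfolding orientations_def by blast
  then show ?thesis by (auto simp: sources_def sinks_def)
qed

lemma poly_eqI_of_nat:
  fixes p q :: "real poly"
  assumes "\<And>m :: nat. poly p (of_nat (m + k)) = poly q (of_nat (m + k))"
  shows "p = q"
proof (rule ccontr)
  assume "p \<noteq> q"
  then have "finite {x. poly (p - q) x = 0}"
    using poly_roots_finite[of "p - q"] by simp
  moreover have "range (\<lambda>m. of_nat (m + k)) \<subseteq> {x. poly (p - q) x = 0}"
    using assms by auto
  ultimately have "finite (range (\<lambda>m. of_nat (m + k) :: real))"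
    by (rule finite_subset[rotated])
  then show False
    using finite_imageD[of "\<lambda>m. of_nat (m + k) :: real" UNIV] by (simp add: inj_on_def)
qed

text \<open>Greene and Zaslavsky's interpretation of the beta invariant.\<close>

theorem beta_invariant_eq_card_bipolar:
  assumes G: "simple_graph V E" and conn: "connected_graph V E" and e: "{s, t} \<in> E"
  shows "beta_invariant V E =
    real (card {D \<in> orientations E. acyclic D \<and> sources D V = {s} \<and> sinks D V = {t}})"
proof -
  have V: "finite V" and st: "s \<in> V" "t \<in> V"
    using G e by (auto simp: simple_graph_def)
  define \<D> where "\<D> = {D \<in> orientations E. acyclic D}"
  have f\<D>: "finite \<D>" using finite_orientations[OF G] by (simp add: \<D>_def)
  define F where "F m D = {f \<in> strict_maps D V {..<m + 2}. f s = 0 \<and> f t = m + 1}" for m D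
  have "\<forall>D\<in>\<D>. \<exists>p :: real poly. (\<forall>m. poly p (of_nat m) = of_nat (card (F m D))) \<and>
      poly p (- 1) = (- 1) ^ card V * (if sources D V = {s} \<and> sinks D V = {t} then 1 else 0)"
    unfolding F_def
    by (intro ballI strict_maps_extremes_fixed_polynomial V st connected_sources_sinks_disjoint[OF conn _ G e])
       (auto simp: \<D>_def)
  then obtain p where p: "\<And>D m. D \<in> \<D> \<Longrightarrow> poly (p D) (of_nat m) = of_nat (card (F m D))"
    and p1: "\<And>D. D \<in> \<D> \<Longrightarrow> poly (p D) (- 1 :: real) =
      (- 1) ^ card V * (if sources D V = {s} \<and> sinks D V = {t} then 1 else 0)"
    by metis
  define M where "M = (\<Sum>D\<in>\<D>. p D)"
  have M: "poly M (of_nat m) =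
      of_nat (card {f \<in> proper_colourings V E (m + 2). f s = 0 \<and> f t = m + 1})" for m
  proof -
    have "{f \<in> proper_colourings V E (m + 2). f s = 0 \<and> f t = m + 1} = (\<Union>D\<in>\<D>. F m D)"
      using proper_colouring_orientation[of _ V E "m + 2"] strict_maps_orientation[OF G]
      unfolding F_def \<D>_def by fast
    then have "card {f \<in> proper_colourings V E (m + 2). f s = 0 \<and> f t = m + 1} =
        card (\<Union>D\<in>\<D>. F m D)" by simp
    also have "\<dots> = (\<Sum>D\<in>\<D>. card (F m D))"
    proof (rule card_UN_disjoint[OF f\<D>])
      show "\<forall>D\<in>\<D>. finite (F m D)" using finite_strict_maps[OF V] by (simp add: F_def)
      show "\<forall>D\<in>\<D>. \<forall>D'\<in>\<D>. D \<noteq> D' \<longrightarrow> F m D \<inter> F m D' = {}"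
        using strict_maps_orientation[OF G] unfolding F_def \<D>_def by blast
    qed
    finally show ?thesis by (simp add: M_def poly_sum p)
  qed
  define c where "c = chromatic_polynomial V E"
  have c: "poly c (of_nat q) = of_nat (card (proper_colourings V E q))" for q
    using theI'[OF ex1_chromatic_polynomial[OF G]] by (simp add: c_def chromatic_polynomial_def)
  \<comment> \<open>In terms of \<open>q = m + 2\<close>, the factors \<open>m + 1\<close> and
    \<open>m + 2\<close> are \<open>q - 1\<close> and \<open>q\<close>, and the argument of
    \<open>M\<close> is \<open>q - 2\<close>.\<close>
  have "c = [:- 1, 1:] * ([:0, 1:] * pcompose M [:- 2, 1:])"
  proof (rule poly_eqI_of_nat[of _ 2])
    fix m :: nat
    have "poly c (of_nat (m + 2)) = of_nat (m + 2) * of_nat (m + 1) * poly M (of_nat m)"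
      by (simp only: c M card_proper_colourings_two_fixed[OF G e, of m] of_nat_mult)
    then show "poly c (of_nat (m + 2)) =
        poly ([:- 1, 1:] * ([:0, 1:] * pcompose M [:- 2, 1:])) (of_nat (m + 2))"
      by (simp add: poly_pcompose algebra_simps)
  qed
  \<comment> \<open>At 1 the factor \<open>q - 1\<close> vanishes, so the product rule leaves only
    the term that differentiates it, and \<open>M\<close> is evaluated at
    \<open>1 - 2\<close>.\<close>
  then have "poly (pderiv c) 1 = poly M (- 1)"
    by (simp only: pderiv_mult) (simp add: poly_pcompose pderiv_pCons)
  also have "\<dots> = (- 1) ^ card V * (\<Sum>D\<in>\<D>. if sources D V = {s} \<and> sinks D V = {t} then 1 else 0)"
    by (simp add: M_def poly_sum p1 sum_distrib_left)
  also have "(\<Sum>D\<in>\<D>. if sources D V = {s} \<and> sinks D V = {t} then 1 else 0 :: real) =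
      card {D \<in> \<D>. sources D V = {s} \<and> sinks D V = {t}}"
    using f\<D> by (simp add: sum.inter_filter[symmetric])
  also have "{D \<in> \<D>. sources D V = {s} \<and> sinks D V = {t}} =
      {D \<in> orientations E. acyclic D \<and> sources D V = {s} \<and> sinks D V = {t}}"
    by (auto simp: \<D>_def)
  finally show ?thesis
    by (simp add: beta_invariant_def c_def abs_mult power_abs)
qed

section \<open>The facets of the order polytope\<close>

text \<open>Rank a vertex by the number of its predecessors in the transitive closure. Along an
  arrow from \<open>u\<close> to \<open>v\<close> these sets grow, and \<open>u\<close> is new by
  acyclicity.\<close>

lemma acyclic_rank:
  assumes "finite D" "acyclic D"
  shows "\<exists>f :: 'v \<Rightarrow> nat. \<forall>(u, v)\<in>D. f u < f v"
proof -
  define f where "f v = card {w. (w, v) \<in> D\<^sup>+}" for v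
  have "f u < f v" if "(u, v) \<in> D" for u v
  proof -
    have "{w. (w, v) \<in> D\<^sup>+} \<subseteq> fst ` (D\<^sup>+)" by force
    then have "finite {w. (w, v) \<in> D\<^sup>+}"
      using assms(1) by (auto intro: finite_subset)
    moreover have "{w. (w, u) \<in> D\<^sup>+} \<subset> {w. (w, v) \<in> D\<^sup>+}"
      using that assms(2) by (auto simp: acyclic_def intro: trancl_into_trancl)
    ultimately show ?thesis unfolding f_def by (rule psubset_card_mono)
  qed
  then show ?thesis by blast
qed

text \<open>The numbers 0 and 1 encode the adjoined bottom and top, \<open>h i\<close> encodes \<open>i \<in> P\<close>.\<close>

locale hat_poset =
  fixes P :: "'a::{finite,order} set" and h :: "'a \<Rightarrow> nat"
  assumes inj: "inj h" and h_ge: "2 \<le> h i"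
begin

section \<open>The poset with bottom and top, and its graph\<close>

definition V :: "nat set" where "V = {0, 1} \<union> h ` P"

definition below :: "nat \<Rightarrow> nat \<Rightarrow> bool" where
  "below u v \<longleftrightarrow> u = 0 \<and> v \<in> V - {0} \<or> v = 1 \<and> u \<in> V - {1} \<or>
     (\<exists>i\<in>P. \<exists>j\<in>P. u = h i \<and> v = h j \<and> i < j)"

definition covers :: "(nat \<times> nat) set" where
  "covers = {(u, v). below u v \<and> (\<nexists>w. below u w \<and> below w v)}"

text \<open>The pair \<open>(0, 1)\<close> is a cover only if \<open>P\<close> is empty, and then it gives no facet.\<close>

definition C :: "(nat \<times> nat) set" where "C = covers - {(0, 1)}"

definition E :: "nat set set" where "E = {{u, v} | u v. (u, v) \<in> insert (0, 1) C}"

text \<open>The constant values at the adjoined elements give the bounds by 0 and 1 the same form as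
  the order constraints.\<close>

definition val :: "(real, 'a) vec \<Rightarrow> nat \<Rightarrow> real" where
  "val x v = (if v = 0 then 0 else if v = 1 then 1 else x $ inv h v)"

definition gap :: "(real, 'a) vec \<Rightarrow> nat \<times> nat \<Rightarrow> real" where
  "gap x = (\<lambda>(u, v). val x v - val x u)"

definition facet :: "nat \<times> nat \<Rightarrow> (real, 'a) vec set" where
  "facet c = {x \<in> order_polytope P. gap x c = 0}"

lemma h_neq [simp]: "h i \<noteq> 0" "h i \<noteq> 1" "h i \<noteq> Suc 0" "0 \<noteq> h i" "Suc 0 \<noteq> h i"
  using h_ge[of i] by auto

lemma h_eq [simp]: "h i = h j \<longleftrightarrow> i = j"
  using inj by (simp add: inj_eq)

lemma val_simps [simp]: "val x 0 = 0" "val x (Suc 0) = 1" "val x (h i) = x $ i"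
  using inj by (auto simp: val_def)

lemma V_cases: assumes "v \<in> V" obtains "v = 0" | "v = 1" | i where "i \<in> P" "v = h i"
  using assms by (auto simp: V_def)

lemma finite_V: "finite V" by (simp add: V_def)

lemma below_V: "below u v \<Longrightarrow> u \<in> V \<and> v \<in> V"
  by (auto simp: below_def V_def)

lemma below_irrefl: "\<not> below u u"
  by (auto simp: below_def)

lemma below_trans: "below u v \<Longrightarrow> below v w \<Longrightarrow> below u w"
  unfolding below_def V_def by (auto intro: less_trans)

lemma below_bot: "v \<in> V \<Longrightarrow> v \<noteq> 0 \<Longrightarrow> below 0 v"
  and below_top: "u \<in> V \<Longrightarrow> u \<noteq> 1 \<Longrightarrow> below u 1"
  by (auto simp: below_def)

lemma not_above_top: "\<not> below 1 v"
  by (auto simp: below_def)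

text \<open>Induction on the size of the open interval from \<open>u\<close> to \<open>v\<close>: an
  element \<open>w\<close> inside splits it into two smaller ones.\<close>

lemma below_imp_trancl_covers: "below u v \<Longrightarrow> (u, v) \<in> covers\<^sup>+"
proof (induction "card {w. below u w \<and> below w v}" arbitrary: u v rule: less_induct)
  case less
  show ?case
  proof (cases "\<exists>w. below u w \<and> below w v")
    case True
    then obtain w where w: "below u w" "below w v" by blast
    have fin: "finite {z. below u z \<and> below z v}" for u v
      using finite_V below_V by (auto intro: finite_subset[of _ V])
    have "card {z. below u z \<and> below z w} < card {z. below u z \<and> below z v}"
      using w by (intro psubset_card_mono fin) (use below_trans below_irrefl in blast)
    moreover have "card {z. below w z \<and> below z v} < card {z. below u z \<and> below z v}"
      using w by (intro psubset_card_mono fin) (use below_trans below_irrefl in blast)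
    ultimately have "(u, w) \<in> covers\<^sup>+" "(w, v) \<in> covers\<^sup>+"
      using less.hyps w by blast+
    then show ?thesis by (rule trancl_trans)
  next
    case False
    then show ?thesis using less.prems by (auto simp: covers_def)
  qed
qed

lemma C_below: "(u, v) \<in> insert (0, 1) C \<Longrightarrow> below u v"
  by (auto simp: C_def covers_def below_def V_def)

lemma C_V: "(u, v) \<in> insert (0, 1) C \<Longrightarrow> u \<in> V \<and> v \<in> V"
  using C_below below_V by blast

lemma finite_C: "finite C"
  by (rule finite_subset[of _ "V \<times> V"]) (use C_V finite_V in auto)

lemma covers_subset: "covers \<subseteq> insert (0, 1) C"
  by (auto simp: C_def)

text \<open>A pair in \<open>C\<close> has an end strictly between 0 and 1. Hence
  \<open>(0, 1)\<close> is not a cover, and nothing was removed.\<close>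

lemma covers_eq_C: assumes "C \<noteq> {}" shows "covers = C"
proof -
  obtain u v where uv: "(u, v) \<in> C" using assms by auto
  then have b: "below u v" "(u, v) \<noteq> (0, 1)" using C_below by (auto simp: C_def)
  have V: "u \<in> V" "v \<in> V" using below_V b(1) by auto
  have "\<exists>w. below 0 w \<and> below w 1"
  proof (cases "u = 0")
    case True
    then have "below v 1" using b V by (intro below_top) auto
    then show ?thesis using b(1) True by blast
  next
    case False
    moreover have "u \<noteq> 1" using b(1) not_above_top by auto
    ultimately show ?thesis using V below_bot below_top by blast
  qed
  then have "(0, 1) \<notin> covers" by (auto simp: covers_def)
  then show ?thesis by (auto simp: C_def)
qed

lemma edge_iff: "{u, v} \<in> E \<longleftrightarrow> (u, v) \<in> insert (0, 1) C \<or> (v, u) \<in> insert (0, 1) C"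
proof -
  have "{u, v} \<in> E \<longleftrightarrow> (\<exists>a b. {u, v} = {a, b} \<and> (a, b) \<in> insert (0, 1) C)"
    by (simp only: E_def mem_Collect_eq)
  then show ?thesis unfolding doubleton_eq_iff by blast
qed

lemma simple_graph_E: "simple_graph V E"
proof -
  have "e \<subseteq> V \<and> card e = 2" if "e \<in> E" for e
  proof -
    obtain u v where e: "e = {u, v}" "(u, v) \<in> insert (0, 1) C"
      using \<open>e \<in> E\<close> by (auto simp only: E_def)
    have "u \<noteq> v" using C_below[OF e(2)] below_irrefl by auto
    then show ?thesis using e C_V[OF e(2)] by simp
  qed
  then show ?thesis using finite_V by (auto simp: simple_graph_def)
qed

text \<open>Chains of covers lead from the bottom to every other vertex.\<close>

lemma connected_graph_E: "connected_graph V E"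
proof -
  define R where "R = {(a, b). {a, b} \<in> E}"
  have "covers \<subseteq> R" using covers_subset edge_iff by (auto simp: R_def)
  have 0: "(0, v) \<in> R\<^sup>*" if "v \<in> V" for v
  proof (cases "v = 0")
    case False
    then have "(0, v) \<in> covers\<^sup>+" by (intro below_imp_trancl_covers below_bot that)
    then show ?thesis
      using trancl_mono[OF _ \<open>covers \<subseteq> R\<close>] by (auto intro: trancl_into_rtrancl)
  qed simp
  have "sym (R\<^sup>*)" by (intro sym_rtrancl) (auto simp: R_def sym_def insert_commute)
  then have "(u, v) \<in> R\<^sup>*" if "u \<in> V" "v \<in> V" for u v
    using 0[OF that(1)] 0[OF that(2)] by (meson rtrancl_trans symD)
  then show ?thesis by (auto simp: connected_graph_def R_def V_def)
qed

text \<open>Take a rank function of \<open>D\<close> and rescale it affinely so that the vertices 0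
  and 1 get the values 0 and 1. The pair \<open>(0, 1)\<close> in \<open>D\<close> makes the scaling
  factor positive. All points with prescribed signs of gaps come from here.\<close>

lemma realisation:
  assumes D: "D \<subseteq> V \<times> V" "acyclic D" "(0, 1) \<in> D"
  obtains x where "x \<in> function_space P" "\<And>u v. (u, v) \<in> D \<Longrightarrow> val x u < val x v"
proof -
  have "finite D" using D(1) finite_V by (auto intro: finite_subset)
  then obtain f :: "nat \<Rightarrow> nat" where f: "\<And>u v. (u, v) \<in> D \<Longrightarrow> f u < f v"
    using acyclic_rank[OF _ D(2)] by auto
  have f01: "f 0 < f 1" using f D(3) by blast
  define g where "g v = (real (f v) - real (f 0)) / (real (f 1) - real (f 0))" for v
  define x where "x = (\<chi> i. if i \<in> P then g (h i) else 0)"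
  have "val x v = g v" if "v \<in> V" for v
    using that f01 by (cases rule: V_cases) (auto simp: x_def g_def)
  moreover have "g u < g v" if "(u, v) \<in> D" for u v
    using f[OF that] f01 by (simp add: g_def divide_strict_right_mono)
  ultimately have "val x u < val x v" if "(u, v) \<in> D" for u v
    using that D(1) by auto
  moreover have "x \<in> function_space P" by (simp add: x_def function_space_def)
  ultimately show ?thesis using that by blast
qed

text \<open>Every relation in the extended poset is a chain of covers, so the inequalities for
  covers imply all others. The pair \<open>(0, 1)\<close> only says that 0 is at most 1.\<close>

lemma order_polytope_eq:
  "order_polytope P = {x \<in> function_space P. \<forall>c\<in>C. 0 \<le> gap x c}"
proof -
  have "order_polytope P = {x \<in> function_space P. \<forall>(u, v)\<in>C. val x u \<le> val x v}"
  proof (intro set_eqI iffI)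
    fix x assume x: "x \<in> order_polytope P"
    have "val x u \<le> val x v" if "(u, v) \<in> C" for u v
      using C_below[of u v] x that
      by (auto simp: below_def V_def order_polytope_def)
    then show "x \<in> {x \<in> function_space P. \<forall>(u, v)\<in>C. val x u \<le> val x v}"
      using x by (auto simp: order_polytope_def)
  next
    fix x assume x: "x \<in> {x \<in> function_space P. \<forall>(u, v)\<in>C. val x u \<le> val x v}"
    have le: "val x u \<le> val x v" if "(u, v) \<in> covers" for u v
      using that x covers_subset by auto
    have "val x u \<le> val x v" if "(u, v) \<in> covers\<^sup>+" for u v
      using that by (induction rule: trancl_induct) (blast intro: le order_trans)+
    then have b: "val x u \<le> val x v" if "below u v" for u v
      using that below_imp_trancl_covers by blast
    have "0 \<le> x $ i \<and> x $ i \<le> 1" if "i \<in> P" for i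
      using b[of 0 "h i"] b[of "h i" 1] that by (auto simp: below_def V_def)
    moreover have "x $ i \<le> x $ j" if "i \<in> P" "j \<in> P" "i \<le> j" for i j
      using b[of "h i" "h j"] that by (cases "i = j") (auto simp: below_def)
    ultimately show "x \<in> order_polytope P"
      using x by (simp add: order_polytope_def)
  qed
  then show ?thesis by (auto simp: gap_def)
qed

section \<open>The constraints as an irredundant system of half-spaces\<close>

lemma gap_affine: "gap ((1 - t) *\<^sub>R x + t *\<^sub>R y) c = (1 - t) * gap x c + t * gap y c"
  by (cases c) (simp add: gap_def val_def algebra_simps)

definition coord :: "nat \<Rightarrow> (real, 'a) vec" where
  "coord v = (if v = 0 \<or> v = 1 then 0 else axis (inv h v) 1)"

lemma val_eq: "val x v = coord v \<bullet> x + (if v = 1 then 1 else 0)"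
  by (simp add: val_def coord_def inner_axis' )

lemma coord_h [simp]: "coord (h i) = axis i 1"
  using inj by (simp add: coord_def)

lemma coord_01 [simp]: "coord 0 = 0" "coord (Suc 0) = 0"
  by (simp_all add: coord_def)

text \<open>With this sign, \<open>0 \<le> gap x c\<close> reads
  \<open>normal c \<bullet> x \<le> offset c\<close>, the standard form of a half-space.\<close>

definition normal :: "nat \<times> nat \<Rightarrow> (real, 'a) vec" where
  "normal = (\<lambda>(u, v). coord u - coord v)"

definition offset :: "nat \<times> nat \<Rightarrow> real" where
  "offset = (\<lambda>(u, v). (if v = 1 then 1 else 0) - (if u = 1 then 1 else 0))"

lemma gap_eq: "gap x c = offset c - normal c \<bullet> x"
  by (cases c) (simp add: gap_def val_eq normal_def offset_def inner_diff_left)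

text \<open>Only the vertices 0 and 1 share a coordinate vector, and the pair \<open>(0, 1)\<close>
  is excluded from \<open>C\<close>.\<close>

lemma normal_nonzero: assumes "c \<in> C" shows "normal c \<noteq> 0"
proof -
  obtain u v where c: "c = (u, v)" by (cases c)
  have b: "below u v" "(u, v) \<noteq> (0, 1)" using assms c C_below by (auto simp: C_def)
  have "axis i 1 \<noteq> (axis j 1 :: (real, 'a) vec)" if "i \<noteq> j" for i j
    using that by (simp add: axis_eq_axis)
  then show ?thesis
    using b unfolding c normal_def below_def V_def by (auto simp: axis_eq_0_iff)
qed

lemma subspace_function_space: "subspace (function_space P)"
  by (simp add: subspace_def function_space_def)

lemma affine_function_space: "affine (function_space P)"
  by (rule subspace_imp_affine[OF subspace_function_space])

lemma acyclic_C: "acyclic (insert (0, 1) C)"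
proof -
  have "trans {(u, v). below u v}" using below_trans by (auto intro: transI)
  then have "acyclic {(u, v). below u v}"
    using below_irrefl by (simp add: acyclic_def trancl_id)
  then show ?thesis by (rule acyclic_subset) (use C_below in auto)
qed

lemma interior_point: "\<exists>x \<in> function_space P. \<forall>c\<in>C. 0 < gap x c"
proof -
  have "insert (0, 1) C \<subseteq> V \<times> V" using C_V by auto
  moreover have "(0, 1) \<in> insert (0, 1) C" by simp
  ultimately obtain x where x: "x \<in> function_space P"
      "\<And>u v. (u, v) \<in> insert (0, 1) C \<Longrightarrow> val x u < val x v"
    using realisation acyclic_C by metis
  have "0 < gap x c" if "c \<in> C" for c
    using that x(2) by (cases c) (simp add: gap_def)
  then show ?thesis using x(1) by blast
qed

text \<open>Reversing a single cover keeps the relation acyclic: any other path from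
  \<open>u\<close> to \<open>v\<close> would pass through an element strictly between them.
  Realising the reversed relation violates this one constraint, so the system is
  irredundant.\<close>

lemma outside_one_halfspace:
  assumes "c \<in> C"
  shows "\<exists>x \<in> function_space P. gap x c < 0 \<and> (\<forall>c'\<in>C - {c}. 0 < gap x c')"
proof -
  obtain u v where c: "c = (u, v)" by (cases c)
  define D where "D = insert (0, 1) C - {(u, v)}"
  have uvC: "(u, v) \<in> C" using assms c by simp
  have uv: "below u v" "\<And>w. below u w \<Longrightarrow> \<not> below w v"
    using uvC by (auto simp: C_def covers_def)
  have "(u, v) \<notin> D\<^sup>*"
  proof
    assume "(u, v) \<in> D\<^sup>*"
    then obtain w where w: "(u, w) \<in> D" "(w, v) \<in> D\<^sup>*"
      using uv(1) below_irrefl by (cases rule: converse_rtranclE) auto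
    have *: "below a b" if "(a, b) \<in> D" for a b
      using that C_below[of a b] by (simp only: D_def) blast
    have "below a b" if "(a, b) \<in> D\<^sup>+" for a b
      using that by (induction rule: trancl_induct) (blast intro: * below_trans)+
    then have "w = v \<or> below w v" using w(2) by (auto simp: rtrancl_eq_or_trancl)
    then show False using w(1) uv(2) *[OF w(1)] by (auto simp: D_def)
  qed
  moreover have "acyclic D" using acyclic_C by (rule acyclic_subset) (auto simp: D_def)
  ultimately have "acyclic (insert (v, u) D)" by (simp only: acyclic_insert) simp
  moreover have "insert (v, u) D \<subseteq> V \<times> V" using C_V uvC by (auto simp: D_def)
  moreover have "(0, 1) \<in> insert (v, u) D" using uvC by (auto simp: D_def C_def)
  ultimately obtain x where x: "x \<in> function_space P"
      "\<And>a b. (a, b) \<in> insert (v, u) D \<Longrightarrow> val x a < val x b"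
    using realisation[of "insert (v, u) D"] by blast
  have "gap x c < 0" using x(2)[of v u] by (simp add: c gap_def)
  moreover have "0 < gap x c'" if "c' \<in> C - {c}" for c'
    using that x(2) by (cases c') (auto simp: c gap_def D_def)
  ultimately show ?thesis using x(1) by blast
qed

text \<open>The points satisfying all constraints strictly form a nonempty, relatively open subset
  of the function space, and such a set spans it.\<close>

lemma affine_hull_order_polytope: "affine hull order_polytope P = function_space P"
proof
  show "affine hull order_polytope P \<subseteq> function_space P"
    by (rule hull_minimal) (auto simp: order_polytope_eq affine_function_space)
  define U where "U = (\<Inter>c\<in>C. {x. normal c \<bullet> x < offset c})"
  have "open U" using finite_C unfolding U_def by (intro open_INT ballI open_halfspace_lt)
  moreover obtain x where x: "x \<in> function_space P" "\<And>c. c \<in> C \<Longrightarrow> 0 < gap x c"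
    using interior_point by blast
  then have "x \<in> function_space P \<inter> U" by (auto simp: U_def gap_eq)
  ultimately have "affine hull (function_space P \<inter> U) = affine hull (function_space P)"
    by (intro affine_hull_affine_Int_open affine_function_space) auto
  moreover have "function_space P \<inter> U \<subseteq> order_polytope P"
    by (auto simp: order_polytope_eq U_def gap_eq less_imp_le)
  ultimately show "function_space P \<subseteq> affine hull order_polytope P"
    using hull_subset[of "function_space P" affine]
      hull_mono[of "function_space P \<inter> U" "order_polytope P" affine] by simp
qed

definition halfspace :: "nat \<times> nat \<Rightarrow> (real, 'a) vec set" where
  "halfspace c = {x. normal c \<bullet> x \<le> offset c}"

lemma halfspace_eq: "halfspace c = {x. 0 \<le> gap x c}"
  by (auto simp: halfspace_def gap_eq)

lemma order_polytope_eq_halfspaces: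
  "order_polytope P = affine hull order_polytope P \<inter> \<Inter> (halfspace ` C)"
  unfolding affine_hull_order_polytope by (auto simp: order_polytope_eq halfspace_eq)

lemma polyhedron_order_polytope: "polyhedron (order_polytope P)"
  unfolding polyhedron_Int_affine
proof (intro exI[of _ "halfspace ` C"] conjI ballI)
  show "order_polytope P = affine hull order_polytope P \<inter> \<Inter> (halfspace ` C)"
    by (rule order_polytope_eq_halfspaces)
  show "\<exists>a b. a \<noteq> 0 \<and> H = {x. a \<bullet> x \<le> b}" if "H \<in> halfspace ` C" for H
    using that normal_nonzero unfolding halfspace_def by auto
qed (simp add: finite_C)

lemma inj_on_halfspace: "inj_on halfspace C"
proof (rule inj_onI, rule ccontr)
  fix c c' assume c: "c \<in> C" "c' \<in> C" "halfspace c = halfspace c'" "c \<noteq> c'"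
  obtain x where "gap x c < 0" "0 < gap x c'"
    using outside_one_halfspace[OF c(1)] c by blast
  then have "x \<in> halfspace c'" "x \<notin> halfspace c" by (auto simp: halfspace_eq)
  then show False using c by simp
qed

text \<open>For an irredundant system of half-spaces, the facets are exactly the sections by the
  bounding hyperplanes. Irredundancy is \<open>outside_one_halfspace\<close>.\<close>

lemma facet_of_order_polytope_iff: "F facet_of order_polytope P \<longleftrightarrow> F \<in> facet ` C"
proof -
  \<comment> \<open>The general theorem indexes normals by half-spaces; injectivity of
    \<open>halfspace\<close> recovers the pair.\<close>
  define a where "a H = normal (inv_into C halfspace H)" for H
  define b where "b H = offset (inv_into C halfspace H)" for H
  have inv: "inv_into C halfspace (halfspace c) = c" if "c \<in> C" for c
    using that inj_on_halfspace by simp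
  have "F facet_of order_polytope P \<longleftrightarrow>
      (\<exists>H. H \<in> halfspace ` C \<and> F = order_polytope P \<inter> {x. a H \<bullet> x = b H})"
  proof (rule facet_of_polyhedron_explicit)
    show "finite (halfspace ` C)" by (simp add: finite_C)
    show "order_polytope P = affine hull order_polytope P \<inter> \<Inter> (halfspace ` C)"
      by (rule order_polytope_eq_halfspaces)
    show "a H \<noteq> 0 \<and> H = {x. a H \<bullet> x \<le> b H}" if "H \<in> halfspace ` C" for H
    proof -
      obtain c where c: "c \<in> C" "H = halfspace c" using \<open>H \<in> halfspace ` C\<close> by blast
      then have "a H = normal c" "b H = offset c" by (simp_all add: a_def b_def inv)
      then show ?thesis using c normal_nonzero by (simp add: halfspace_def)
    qed
    show "order_polytope P \<subset> affine hull order_polytope P \<inter> \<Inter> F'" if F': "F' \<subset> halfspace ` C" for F'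
    proof -
      obtain c where c: "c \<in> C" "halfspace c \<notin> F'" using F' by blast
      obtain x where x: "x \<in> function_space P" "gap x c < 0" "\<And>c'. c' \<in> C - {c} \<Longrightarrow> 0 < gap x c'"
        using outside_one_halfspace[OF c(1)] by blast
      have "x \<in> H" if "H \<in> F'" for H
      proof -
        obtain c' where "c' \<in> C" "H = halfspace c'" using \<open>H \<in> F'\<close> F' by blast
        moreover have "c' \<noteq> c" using c(2) \<open>H \<in> F'\<close> \<open>H = halfspace c'\<close> by blast
        ultimately show ?thesis using x(3)[of c'] by (simp add: halfspace_eq)
      qed
      moreover have "x \<notin> order_polytope P" using x(2) c(1) by (force simp: order_polytope_eq)
      moreover have "order_polytope P \<subseteq> affine hull order_polytope P \<inter> \<Inter> F'"
        using order_polytope_eq_halfspaces F' by blast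
      ultimately show ?thesis using x(1) affine_hull_order_polytope by blast
    qed
  qed
  also have "\<dots> \<longleftrightarrow> (\<exists>c\<in>C. F = order_polytope P \<inter> {x. normal c \<bullet> x = offset c})"
    by (auto simp: a_def b_def inv)
  also have "\<dots> \<longleftrightarrow> F \<in> facet ` C"
  proof -
    have "facet c = order_polytope P \<inter> {x. normal c \<bullet> x = offset c}" for c
      by (auto simp: facet_def gap_eq)
    then show ?thesis by (simp add: image_iff)
  qed
  finally show ?thesis .
qed

lemma rel_frontier_order_polytope:
  "rel_frontier (order_polytope P) = {x \<in> order_polytope P. \<exists>c\<in>C. gap x c = 0}"
  unfolding rel_frontier_of_polyhedron[OF polyhedron_order_polytope]
  by (auto simp: facet_of_order_polytope_iff facet_def)

text \<open>Join an interior point to a point violating only \<open>c\<close>. Where the segment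
  crosses the hyperplane of \<open>c\<close>, all other constraints still hold strictly.\<close>

lemma facet_point:
  assumes "c \<in> C"
  shows "\<exists>z \<in> facet c. \<forall>c'\<in>C - {c}. 0 < gap z c'"
proof -
  obtain x where x: "x \<in> function_space P" "gap x c < 0" "\<And>c'. c' \<in> C - {c} \<Longrightarrow> 0 < gap x c'"
    using outside_one_halfspace[OF assms] by blast
  obtain p where p: "p \<in> function_space P" "\<And>c. c \<in> C \<Longrightarrow> 0 < gap p c"
    using interior_point by blast
  define t where "t = gap p c / (gap p c - gap x c)"
  have pc: "0 < gap p c" using p(2) assms .
  have t: "0 < t" "t < 1" using pc x(2) by (auto simp: t_def)
  define z where "z = (1 - t) *\<^sub>R p + t *\<^sub>R x"
  have "z \<in> function_space P"
    using p(1) x(1) subspace_function_space by (simp add: z_def subspace_add subspace_scale)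
  moreover have "gap z c = 0"
    unfolding z_def gap_affine using pc x(2) by (simp add: t_def field_simps)
  moreover have "0 < gap z c'" if "c' \<in> C - {c}" for c'
    using t x(3)[OF that] p(2)[of c'] that by (simp add: z_def gap_affine add_pos_pos)
  moreover from calculation have "0 \<le> gap z c'" if "c' \<in> C" for c'
  proof (cases "c' = c")
    case False
    then have "c' \<in> C - {c}" using that by simp
    then show ?thesis using calculation(3) less_imp_le by blast
  qed (use \<open>gap z c = 0\<close> in simp)
  ultimately show ?thesis
    by (intro bexI[of _ z]) (auto simp: facet_def order_polytope_eq)
qed

lemma inj_on_facet: "inj_on facet C"
proof (rule inj_onI, rule ccontr)
  fix c c' assume c: "c \<in> C" "c' \<in> C" "facet c = facet c'" "c \<noteq> c'"
  obtain z where "z \<in> facet c" "0 < gap z c'" using facet_point[OF c(1)] c by blast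
  then have "z \<in> facet c'" using c(3) by simp
  then show False using \<open>0 < gap z c'\<close> by (simp add: facet_def)
qed

text \<open>A face that meets the relative interior of a facet contains the whole facet, which
  \<open>facet_point\<close> rules out for two different constraints.\<close>

lemma gap_rel_interior_facet:
  assumes c: "c \<in> C" and y: "y \<in> rel_interior (facet c)" and c': "c' \<in> C" "c' \<noteq> c"
  shows "0 < gap y c'"
proof (rule ccontr)
  assume less: "\<not> 0 < gap y c'"
  have "y \<in> order_polytope P" using y rel_interior_subset[of "facet c"] by (auto simp: facet_def)
  moreover from this have "0 \<le> gap y c'" using c'(1) by (simp add: order_polytope_eq)
  ultimately have "y \<in> facet c'" using less by (simp add: facet_def)
  moreover have "facet c' face_of order_polytope P"
    using c' facet_of_order_polytope_iff facet_of_imp_face_of by blast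
  moreover have "facet c \<subseteq> order_polytope P" by (auto simp: facet_def)
  ultimately have sub: "facet c \<subseteq> facet c'"
    using y subset_of_face_of[of "facet c'" "order_polytope P" "facet c"] by blast
  obtain z where "z \<in> facet c" "0 < gap z c'" using facet_point[OF c] c' by blast
  then show False using sub by (auto simp: facet_def)
qed

lemma rel_interior_facet_nonempty:
  assumes "c \<in> C"
  shows "rel_interior (facet c) \<noteq> {}"
proof -
  have "facet c facet_of order_polytope P" using assms by (simp add: facet_of_order_polytope_iff)
  then have "convex (facet c)" by (intro face_of_imp_convex facet_of_imp_face_of)
  moreover have "facet c \<noteq> {}" using facet_point[OF assms] by blast
  ultimately show ?thesis by (simp add: rel_interior_eq_empty)
qed

text \<open>The facet and the hyperplane section of the function space both have dimension one less
  than the polytope, and nested affine sets of equal dimension coincide.\<close>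

lemma affine_hull_facet:
  assumes c: "c \<in> C"
  shows "affine hull facet c = {x \<in> function_space P. gap x c = 0}"
proof -
  define T where "T = function_space P \<inter> {x. normal c \<bullet> x = offset c}"
  have T: "T = {x \<in> function_space P. gap x c = 0}" by (auto simp: T_def gap_eq)
  have sub: "facet c \<subseteq> T" by (auto simp: T facet_def order_polytope_eq)
  have F: "facet c facet_of order_polytope P" using c facet_of_order_polytope_iff by blast
  obtain z where z: "z \<in> facet c" using facet_point[OF c] by blast
  obtain p where p: "p \<in> function_space P" "0 < gap p c" using interior_point c by metis
  have aT: "affine T"
    unfolding T_def by (intro affine_Int affine_function_space affine_hyperplane)
  have ne: "function_space P \<inter> {x. normal c \<bullet> x = offset c} \<noteq> {}"
    using z sub unfolding T_def by blast
  have nsub: "\<not> function_space P \<subseteq> {x. normal c \<bullet> x = offset c}"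
    using p by (auto simp: gap_eq)
  have "aff_dim (function_space P) = aff_dim (order_polytope P)"
    using aff_dim_affine_hull[of "order_polytope P"] by (simp add: affine_hull_order_polytope)
  moreover have "aff_dim T = aff_dim (function_space P) - 1"
    unfolding T_def aff_dim_affine_Int_hyperplane[OF affine_function_space]
    using ne nsub by simp
  moreover have "aff_dim (facet c) = aff_dim (order_polytope P) - 1"
    using F by (simp add: facet_of_def)
  ultimately have "aff_dim (affine hull facet c) = aff_dim T" by simp
  then have "affine hull facet c = T"
    using sub z aT by (intro affine_dim_equal hull_minimal) auto
  then show ?thesis by (simp add: T)
qed

lemma generic_points_eq:
  "generic_points (function_space P) (order_polytope P) =
   {x \<in> function_space P. \<forall>c\<in>C. gap x c \<noteq> 0}"
proof -
  have "visibility_arrangement (order_polytope P) = (\<lambda>c. affine hull facet c) ` C"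
    by (auto simp: visibility_arrangement_def facet_of_order_polytope_iff)
  then show ?thesis by (auto simp: generic_points_def affine_hull_facet)
qed

subsection \<open>Visibility and acyclic orientations\<close>

text \<open>A generic point of the polytope satisfies all constraints strictly, and so do all points
  of the segment before \<open>y\<close>. From outside, if \<open>c\<close> is violated, the segment
  stays beyond its hyperplane until it ends in \<open>y\<close>. If \<open>c\<close> is satisfied,
  the segment runs through the polytope before reaching \<open>y\<close> and meets the boundary at
  an earlier point.\<close>

lemma visible_from_facet_iff:
  assumes x: "x \<in> function_space P" "\<And>c. c \<in> C \<Longrightarrow> gap x c \<noteq> 0" and c: "c \<in> C"
  shows "visible_from (order_polytope P) x (facet c) \<longleftrightarrow> x \<in> order_polytope P \<or> gap x c < 0"
proof
  assume vis: "visible_from (order_polytope P) x (facet c)"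
  show "x \<in> order_polytope P \<or> gap x c < 0"
  proof (rule ccontr)
    assume "\<not> (x \<in> order_polytope P \<or> gap x c < 0)"
    then have out: "x \<notin> order_polytope P" and xc: "0 < gap x c"
      using x(2)[OF c] by auto
    obtain y where y: "y \<in> rel_interior (facet c)"
      using rel_interior_facet_nonempty[OF c] by blast
    have "y \<in> facet c" using y rel_interior_subset by blast
    then have yS: "y \<in> order_polytope P" and yc: "gap y c = 0" by (auto simp: facet_def)
    \<comment> \<open>The constraints violated by \<open>x\<close>; \<open>\<tau> c'\<close> is the
      parameter at which the segment from \<open>y\<close> to \<open>x\<close> crosses the
      hyperplane of \<open>c'\<close>. At the first crossing the segment leaves the
      polytope.\<close>
    define R where "R = {c' \<in> C. gap x c' < 0}"
    define \<tau> where "\<tau> c' = gap y c' / (gap y c' - gap x c')" for c'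
    have R: "finite R" "R \<noteq> {}"
      using finite_C out x(1) by (auto simp: R_def order_polytope_eq not_le)
    define d where "d = arg_min_on \<tau> R"
    have d: "d \<in> R" and min: "\<tau> d \<le> \<tau> c'" if "c' \<in> R" for c'
      using arg_min_if_finite[OF R, of \<tau>] that by (auto simp: d_def not_less)
    have yR: "0 < gap y c'" if "c' \<in> R" for c'
      using that xc by (intro gap_rel_interior_facet[OF c y]) (auto simp: R_def)
    have dR: "d \<in> R" using d R(2) by blast
    define t where "t = \<tau> d"
    have t: "0 < t" "t < 1"
      using yR[OF dR] dR by (auto simp: t_def \<tau>_def R_def)
    define z where "z = (1 - t) *\<^sub>R y + t *\<^sub>R x"
    have "0 \<le> gap z c'" if c': "c' \<in> C" for c'
    proof (cases "c' \<in> R")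
      case True
      then have "t \<le> gap y c' / (gap y c' - gap x c')" using min by (simp add: t_def \<tau>_def)
      then have "t * (gap y c' - gap x c') \<le> gap y c'"
        using True yR[OF True] by (simp add: R_def pos_le_divide_eq)
      then show ?thesis unfolding z_def gap_affine by (simp add: algebra_simps)
    next
      case False
      then have "0 \<le> gap x c'" "0 \<le> gap y c'"
        using c' yS by (auto simp: R_def order_polytope_eq)
      then show ?thesis using t by (simp add: z_def gap_affine)
    qed
    moreover have "z \<in> function_space P"
      using x(1) yS subspace_function_space
      by (simp add: z_def order_polytope_eq subspace_add subspace_scale)
    moreover have "gap z d = 0"
    proof -
      have "t * (gap y d - gap x d) = gap y d"
        using yR[OF dR] dR by (simp add: t_def \<tau>_def R_def)
      then show ?thesis unfolding z_def gap_affine by (simp add: algebra_simps)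
    qed
    moreover have "d \<in> C" using dR by (simp add: R_def)
    ultimately have "z \<in> {x \<in> order_polytope P. \<exists>c\<in>C. gap x c = 0}"
      unfolding order_polytope_eq by blast
    then have "z \<in> rel_frontier (order_polytope P)" by (simp only: rel_frontier_order_polytope)
    moreover have "z \<in> closed_segment x y"
      unfolding closed_segment_commute[of x y] in_segment z_def
      using t by (intro exI[of _ t]) simp
    moreover have "closed_segment x y \<inter> rel_frontier (order_polytope P) = {y}"
      using vis y unfolding visible_from_def by blast
    ultimately have "z = y" by blast
    \<comment> \<open>From \<open>y\<close> towards \<open>x\<close> the gap of \<open>c\<close>
      grows from 0, so the exit point differs from \<open>y\<close>.\<close>
    then have "gap z c = 0" using yc by simp
    then show False using t xc yc by (simp add: z_def gap_affine)
  qed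
next
  assume disj: "x \<in> order_polytope P \<or> gap x c < 0"
  show "visible_from (order_polytope P) x (facet c)"
    unfolding visible_from_def
  proof (intro conjI ballI)
    show "facet c facet_of order_polytope P" using c by (simp add: facet_of_order_polytope_iff)
    fix y assume y: "y \<in> rel_interior (facet c)"
    have "y \<in> facet c" using y rel_interior_subset by blast
    then have yS: "y \<in> order_polytope P" and yc: "gap y c = 0" by (auto simp: facet_def)
    have "z = y" if "z \<in> closed_segment x y" and fr: "z \<in> rel_frontier (order_polytope P)" for z
    proof (rule ccontr)
      assume "z \<noteq> y"
      obtain t where z: "z = (1 - t) *\<^sub>R y + t *\<^sub>R x" and t01: "0 \<le> t" "t \<le> 1"
        using \<open>z \<in> closed_segment x y\<close> unfolding closed_segment_commute[of x y] by (auto simp: in_segment)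
      have t: "0 < t" using \<open>z \<noteq> y\<close> z t01 by (cases "t = 0") auto
      have zS: "z \<in> order_polytope P" using fr by (simp add: rel_frontier_order_polytope)
      show False
      proof (cases "x \<in> order_polytope P")
        case True
        obtain d where d: "d \<in> C" "gap z d = 0" using fr by (auto simp: rel_frontier_order_polytope)
        have "0 \<le> gap x d" "0 \<le> gap y d" using d True yS by (auto simp: order_polytope_eq)
        then have "0 < gap x d" "0 \<le> gap y d" using x(2)[OF d(1)] by auto
        then have "0 < t * gap x d" "0 \<le> (1 - t) * gap y d" using t t01 by simp_all
        then show False using d(2) by (simp add: z gap_affine)
      next
        case False
        then have "gap x c < 0" using disj by blast
        then have "gap z c < 0" using t yc by (simp add: z gap_affine mult_pos_neg)
        then show False using zS c by (force simp: order_polytope_eq)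
      qed
    qed
    moreover have "y \<in> rel_frontier (order_polytope P)"
      using yS yc c by (auto simp: rel_frontier_order_polytope)
    ultimately show "closed_segment x y \<inter> rel_frontier (order_polytope P) = {y}" by auto
  qed
qed

section \<open>Visible facets and violated constraints\<close>

definition violated :: "(real, 'a) vec \<Rightarrow> (nat \<times> nat) set" where
  "violated x = {c \<in> C. gap x c < 0}"

text \<open>A point violating no constraint sees every facet, any other point only those whose
  constraint it violates.\<close>

definition seen :: "(nat \<times> nat) set \<Rightarrow> (real, 'a) vec set set" where
  "seen R = facet ` (if R = {} then C else R)"

abbreviation generic :: "(real, 'a) vec set" where
  "generic \<equiv> generic_points (function_space P) (order_polytope P)"

lemma visible_eq_seen:
  assumes "x \<in> generic"
  shows "Collect (visible_from (order_polytope P) x) = seen (violated x)"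
proof -
  have x: "x \<in> function_space P" "\<And>c. c \<in> C \<Longrightarrow> gap x c \<noteq> 0"
    using assms by (auto simp: generic_points_eq)
  have in_iff: "x \<in> order_polytope P \<longleftrightarrow> violated x = {}"
    using x(1) by (force simp: order_polytope_eq violated_def)
  have "visible_from (order_polytope P) x F \<longleftrightarrow>
      (\<exists>c\<in>C. F = facet c \<and> (violated x = {} \<or> c \<in> violated x))" for F
  proof -
    have "visible_from (order_polytope P) x F \<longleftrightarrow>
        (\<exists>c\<in>C. F = facet c \<and> visible_from (order_polytope P) x (facet c))"
      using facet_of_order_polytope_iff[of F] unfolding visible_from_def by blast
    also have "\<dots> \<longleftrightarrow> (\<exists>c\<in>C. F = facet c \<and> (violated x = {} \<or> c \<in> violated x))"
    proof (intro bex_cong refl conj_cong)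
      fix c assume "c \<in> C"
      then show "visible_from (order_polytope P) x (facet c) \<longleftrightarrow> violated x = {} \<or> c \<in> violated x"
        using visible_from_facet_iff[OF x] in_iff by (simp add: violated_def)
    qed
    finally show ?thesis .
  qed
  then show ?thesis
    by (auto simp: seen_def violated_def image_iff)
qed

text \<open>If all constraints were violated, the values would decrease along a chain of covers from
  0 to 1, although they are 0 and 1 at its ends.\<close>

lemma violated_neq_C:
  assumes "C \<noteq> {}"
  shows "violated x \<noteq> C"
proof
  assume eq: "violated x = C"
  have less: "val x v < val x u" if "(u, v) \<in> C" for u v
  proof -
    have "(u, v) \<in> violated x" using that eq by simp
    then show ?thesis by (simp add: violated_def gap_def)
  qed
  have "val x v < val x u" if "(u, v) \<in> C\<^sup>+" for u v
    using that by (induction rule: trancl_induct) (blast intro: less less_trans)+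
  moreover have "(0, 1) \<in> C\<^sup>+"
    using below_imp_trancl_covers[of 0 1] covers_eq_C[OF assms] by (simp add: below_def V_def)
  ultimately have "val x 1 < val x 0" by blast
  then show False by simp
qed

lemma inj_on_seen: "inj_on seen {R. R \<subseteq> C \<and> (R = C \<longrightarrow> C = {})}"
proof (rule inj_onI)
  fix R R' assume R: "R \<in> {R. R \<subseteq> C \<and> (R = C \<longrightarrow> C = {})}" "R' \<in> {R. R \<subseteq> C \<and> (R = C \<longrightarrow> C = {})}"
    and eq: "seen R = seen R'"
  have "(if R = {} then C else R) = (if R' = {} then C else R')"
    using eq R unfolding seen_def by (subst (asm) inj_on_image_eq_iff[OF inj_on_facet]) auto
  then show "R = R'" using R by (auto split: if_splits)
qed

section \<open>Orientations induced by generic points\<close>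

definition orient :: "(real, 'a) vec \<Rightarrow> (nat \<times> nat) set" where
  "orient x = {(u, v). {u, v} \<in> E \<and> val x u < val x v}"

definition admissible :: "(nat \<times> nat) set set" where
  "admissible = {D \<in> orientations E. acyclic D \<and> (0, 1) \<in> D}"

lemma edge_val_neq:
  assumes "x \<in> generic" "{u, v} \<in> E"
  shows "val x u \<noteq> val x v"
proof -
  have *: "val x a \<noteq> val x b" if "(a, b) \<in> insert (0, 1) C" for a b
    using that assms(1) unfolding generic_points_eq by (auto simp: gap_def)
  show ?thesis using assms(2) *[of u v] *[of v u] unfolding edge_iff by auto
qed

lemma edge_01: "{0, 1} \<in> E"
  by (subst edge_iff) simp

lemma orient_admissible:
  assumes "x \<in> generic"
  shows "orient x \<in> admissible"
proof -
  have "val x u < val x v" if "(u, v) \<in> (orient x)\<^sup>+" for u v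
    using that by (induction rule: trancl_induct) (auto simp: orient_def)
  then have "acyclic (orient x)" by (force simp: acyclic_def)
  moreover have "(0, 1) \<in> orient x" using edge_01 by (simp add: orient_def)
  moreover have "orient x \<in> orientations E"
  proof -
    have "(u, v) \<in> orient x \<longleftrightarrow> (v, u) \<notin> orient x" if "{u, v} \<in> E" for u v
    proof -
      have "{v, u} \<in> E" using that by (subst insert_commute)
      then show ?thesis using that edge_val_neq[OF assms that] by (simp add: orient_def) linarith
    qed
    then show ?thesis by (simp add: orientations_def orient_def)
  qed
  ultimately show ?thesis by (simp add: admissible_def)
qed

lemma admissible_edge: "D \<in> admissible \<Longrightarrow> (u, v) \<in> D \<Longrightarrow> {u, v} \<in> E"
  by (simp add: admissible_def orientations_def)

lemma admissible_total: "D \<in> admissible \<Longrightarrow> {u, v} \<in> E \<Longrightarrow> (u, v) \<in> D \<longleftrightarrow> (v, u) \<notin> D"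
  by (simp add: admissible_def orientations_def)

lemma admissible_subset: "D \<in> admissible \<Longrightarrow> D \<subseteq> V \<times> V"
  using admissible_edge simple_graph_E unfolding simple_graph_def by fast

lemma violated_eq: "violated x = C \<inter> (orient x)\<inverse>"
proof -
  have "c \<in> violated x \<longleftrightarrow> c \<in> C \<inter> (orient x)\<inverse>" for c
    by (cases c) (auto simp: violated_def gap_def orient_def edge_iff)
  then show ?thesis by blast
qed

lemma orient_eqI:
  assumes D: "D \<in> admissible" and x: "x \<in> function_space P"
    and less: "\<And>u v. (u, v) \<in> D \<Longrightarrow> val x u < val x v"
  shows "x \<in> generic" "orient x = D"
proof -
  have "gap x c \<noteq> 0" if "c \<in> C" for c
  proof -
    obtain u v where c: "c = (u, v)" by (cases c)
    then have "{u, v} \<in> E" using that by (simp add: edge_iff)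
    then have "(u, v) \<in> D \<or> (v, u) \<in> D" using admissible_total[OF D] by blast
    then show ?thesis using less[of u v] less[of v u] by (auto simp: c gap_def)
  qed
  then show "x \<in> generic" using x by (simp add: generic_points_eq)
  have "(u, v) \<in> orient x \<longleftrightarrow> (u, v) \<in> D" for u v
    using less[of u v] less[of v u] admissible_edge[OF D, of u v] admissible_total[OF D, of u v]
    by (auto simp: orient_def)
  then show "orient x = D" by auto
qed

lemma orient_surj:
  assumes "D \<in> admissible"
  shows "\<exists>x\<in>generic. orient x = D"
proof -
  have "acyclic D" "(0, 1) \<in> D" using assms by (auto simp: admissible_def)
  then obtain x where "x \<in> function_space P" "\<And>u v. (u, v) \<in> D \<Longrightarrow> val x u < val x v"
    using realisation[OF admissible_subset[OF assms]] by blast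
  then show ?thesis using orient_eqI[OF assms] by blast
qed

definition visibility :: "(nat \<times> nat) set \<Rightarrow> (real, 'a) vec set set" where
  "visibility D = seen (C \<inter> D\<inverse>)"

lemma visible_eq_visibility:
  "x \<in> generic \<Longrightarrow> Collect (visible_from (order_polytope P) x) = visibility (orient x)"
  by (simp add: visible_eq_seen visibility_def violated_eq)

text \<open>The downward covers determine the orientation: all other covers point upwards, and the
  extra edge has a fixed direction.\<close>

lemma admissible_subsetI:
  assumes D: "D \<in> admissible" "D' \<in> admissible" and eq: "C \<inter> D\<inverse> = C \<inter> D'\<inverse>"
  shows "D \<subseteq> D'"
proof
  fix e assume e: "e \<in> D"
  obtain u v where uv: "e = (u, v)" by (cases e)
  have uvE: "{u, v} \<in> E" using admissible_edge[OF D(1)] e uv by simp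
  have 01: "(0, 1) \<in> D" "(0, 1) \<in> D'" using D by (auto simp: admissible_def)
  have tot: "(v, u) \<notin> D" "(v, u) \<notin> D' \<Longrightarrow> (u, v) \<in> D'"
    using admissible_total[OF D(1) uvE] admissible_total[OF D(2) uvE] e uv by auto
  consider "(u, v) = (0, 1)" | "(v, u) = (0, 1)" | "(u, v) \<in> C" | "(v, u) \<in> C"
    using uvE unfolding edge_iff by blast
  then show "e \<in> D'"
  proof cases
    case 3
    then have "(u, v) \<notin> C \<inter> D'\<inverse>" using tot(1) unfolding eq[symmetric] by blast
    then show ?thesis using 3 tot(2) uv by blast
  next
    case 4
    then have "(v, u) \<in> C \<inter> D'\<inverse>" using e uv unfolding eq[symmetric] by blast
    then show ?thesis using uv by blast
  qed (use 01 tot uv in auto)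
qed

lemma inj_on_visibility: "inj_on visibility admissible"
proof (rule inj_onI)
  fix D D' assume D: "D \<in> admissible" "D' \<in> admissible" and eq: "visibility D = visibility D'"
  have "C \<inter> D\<inverse> \<in> {R. R \<subseteq> C \<and> (R = C \<longrightarrow> C = {})}" if "D \<in> admissible" for D
    using orient_surj[OF that] violated_eq violated_neq_C by fast
  then have "C \<inter> D\<inverse> = C \<inter> D'\<inverse>"
    using inj_onD[OF inj_on_seen] eq D unfolding visibility_def by blast
  then show "D = D'" using admissible_subsetI D by blast
qed

lemma finite_admissible: "finite admissible"
  using finite_orientations[OF simple_graph_E] by (simp add: admissible_def)

lemma visibility_sets_eq:
  "visibility_sets (function_space P) (order_polytope P) = visibility ` admissible"
proof -
  have "visibility_sets (function_space P) (order_polytope P) = (\<lambda>x. visibility (orient x)) ` generic"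
    using visible_eq_visibility unfolding visibility_sets_def by (auto simp: image_iff)
  also have "\<dots> = visibility ` admissible"
    using orient_admissible orient_surj by (fastforce simp: image_iff)
  finally show ?thesis .
qed

text \<open>Since \<open>visibility\<close> is injective on admissible orientations, generic points
  with equal visibility sets have equal orientations. So being visible from far away is a property
  of the orientation.\<close>

lemma far_visibility_sets_eq:
  "far_visibility_sets (function_space P) (order_polytope P) =
   visibility ` {D \<in> admissible. \<forall>R. \<exists>x\<in>generic. R \<le> norm x \<and> orient x = D}"
proof (intro set_eqI iffI)
  fix \<V> assume "\<V> \<in> far_visibility_sets (function_space P) (order_polytope P)"
  then have far: "\<exists>x\<in>generic. R \<le> norm x \<and> visibility (orient x) = \<V>" for R
    using visible_eq_visibility unfolding far_visibility_sets_def by fastforce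
  then obtain x where x: "x \<in> generic" "visibility (orient x) = \<V>" by blast
  have "\<exists>y\<in>generic. R \<le> norm y \<and> orient y = orient x" for R
  proof -
    obtain y where y: "y \<in> generic" "R \<le> norm y" "visibility (orient y) = \<V>" using far by blast
    then have "orient y = orient x"
      using inj_onD[OF inj_on_visibility] orient_admissible x by metis
    then show ?thesis using y by blast
  qed
  then show "\<V> \<in> visibility ` {D \<in> admissible. \<forall>R. \<exists>x\<in>generic. R \<le> norm x \<and> orient x = D}"
    using x orient_admissible by blast
next
  fix \<V> assume "\<V> \<in> visibility ` {D \<in> admissible. \<forall>R. \<exists>x\<in>generic. R \<le> norm x \<and> orient x = D}"
  then obtain D where "\<V> = visibility D" "\<And>R. \<exists>x\<in>generic. R \<le> norm x \<and> orient x = D" by blast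
  then show "\<V> \<in> far_visibility_sets (function_space P) (order_polytope P)"
    using visible_eq_visibility unfolding far_visibility_sets_def by fastforce
qed

section \<open>Bounded and unbounded chambers\<close>

definition bipolar :: "(nat \<times> nat) set set" where
  "bipolar = {D \<in> orientations E. acyclic D \<and> sources D V = {0} \<and> sinks D V = {1}}"

lemma bipolar_subset: "bipolar \<subseteq> admissible"
proof
  fix D assume D: "D \<in> bipolar"
  then have "0 \<in> sources D V" by (simp add: bipolar_def)
  then have "(1, 0) \<notin> D" by (auto simp: sources_def V_def)
  then show "D \<in> admissible"
    using D edge_01 by (auto simp: bipolar_def admissible_def orientations_def)
qed

text \<open>A vertex of least value is a source and one of greatest value a sink, so these are 0 and
  1. Hence all coordinates lie between 0 and 1, and the sum of their absolute values bounds the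
  norm.\<close>

lemma bipolar_bounded:
  assumes x: "x \<in> generic" and b: "orient x \<in> bipolar"
  shows "norm x \<le> real CARD('a)"
proof -
  have V: "finite V" "V \<noteq> {}" using finite_V by (auto simp: V_def)
  define a where "a = arg_min_on (val x) V"
  have a: "a \<in> V" "\<And>v. v \<in> V \<Longrightarrow> val x a \<le> val x v"
    using arg_min_if_finite[OF V, of "val x"] by (auto simp: a_def not_less)
  then have "a \<in> sources (orient x) V" by (force simp: sources_def orient_def)
  then have "a = 0" using b by (simp add: bipolar_def)
  define c where "c = arg_min_on (\<lambda>v. - val x v) V"
  have c: "c \<in> V" "\<And>v. v \<in> V \<Longrightarrow> val x v \<le> val x c"
    using arg_min_if_finite[OF V, of "\<lambda>v. - val x v"] by (auto simp: c_def not_less)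
  then have "c \<in> sinks (orient x) V" by (force simp: sinks_def orient_def)
  then have "c = 1" using b by (simp add: bipolar_def)
  have "\<bar>x $ i\<bar> \<le> 1" for i
  proof (cases "i \<in> P")
    case True
    then have "h i \<in> V" by (simp add: V_def)
    then show ?thesis
      using a(2)[of "h i"] c(2)[of "h i"] \<open>a = 0\<close> \<open>c = 1\<close> by simp
  next
    case False
    moreover have "x \<in> function_space P" using x by (simp add: generic_points_eq)
    ultimately show ?thesis by (simp add: function_space_def)
  qed
  then have "(\<Sum>i\<in>UNIV. \<bar>x $ i\<bar>) \<le> (\<Sum>i\<in>(UNIV :: 'a set). 1)" by (intro sum_mono)
  then show ?thesis using norm_le_l1_cart[of x] by simp
qed

text \<open>There is a source other than 0 or a sink other than 1. Lowering the value of such a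
  source, or raising that of such a sink, keeps all strict inequalities along
  \<open>D\<close>.\<close>

lemma not_bipolar_unbounded:
  assumes D: "D \<in> admissible - bipolar"
  shows "\<exists>x\<in>generic. R \<le> norm x \<and> orient x = D"
proof -
  have DA: "D \<in> admissible" and D01: "(0, 1) \<in> D" and ac: "acyclic D"
    using D by (auto simp: admissible_def)
  have V: "finite V" "V \<noteq> {}" "0 \<in> V" "1 \<in> V" using finite_V by (auto simp: V_def)
  have DV: "D \<subseteq> V \<times> V" by (rule admissible_subset[OF DA])
  obtain x where x: "x \<in> function_space P" "\<And>u v. (u, v) \<in> D \<Longrightarrow> val x u < val x v"
    using realisation[OF DV ac D01] by blast
  have "\<not> (sources D V = {0} \<and> sinks D V = {1})"
    using D by (simp add: bipolar_def admissible_def)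
  moreover have "\<exists>v\<in>S. v \<noteq> a" if "S \<noteq> {}" "S \<noteq> {a}" for S and a :: nat
    using that by auto
  ultimately obtain v where v: "v \<in> sources D V \<and> v \<noteq> 0 \<or> v \<in> sinks D V \<and> v \<noteq> 1"
    using sources_nonempty[OF V(1,2) ac] sinks_nonempty[OF V(1,2) ac] by metis
  have "v \<in> V" using v sources_subset[of D V] sinks_subset[of D V] by blast
  \<comment> \<open>The pair \<open>(0, 1)\<close> enters 1 and leaves 0, so \<open>v\<close> is
    neither of them and has a coordinate that can be moved.\<close>
  moreover have "1 \<notin> sources D V" "0 \<notin> sinks D V"
    using D01 V(3,4) unfolding sources_def sinks_def by blast+
  then have "v \<noteq> 0" "v \<noteq> 1" using v by metis+
  ultimately obtain i where i: "i \<in> P" "v = h i" by (auto elim: V_cases)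
  \<comment> \<open>Moving a coordinate by this amount makes the norm of \<open>y\<close> at least
    \<open>R\<close>, by the triangle inequality.\<close>
  define q where "q = \<bar>R\<bar> + norm x"
  have q: "0 \<le> q" by (simp add: q_def)
  define r where "r = q * (if v \<in> sources D V then - 1 else 1)"
  define y where "y = x + r *\<^sub>R axis i 1"
  have r_sign: "v \<in> sources D V \<Longrightarrow> r \<le> 0" "v \<notin> sources D V \<Longrightarrow> 0 \<le> r"
    using q by (simp_all add: r_def)
  have "norm (r *\<^sub>R axis i 1 :: (real, 'a) vec) = \<bar>R\<bar> + norm x"
    using q by (simp add: r_def abs_mult q_def[symmetric])
  then have "R \<le> norm y"
    unfolding y_def using norm_diff_ineq[of "r *\<^sub>R axis i 1 :: (real, 'a) vec" x] by (simp add: add.commute)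
  have yP: "y \<in> function_space P"
    using x(1) i(1) by (auto simp: y_def function_space_def axis_def)
  have val: "val y w = val x w + (if w = v then r else 0)" if "w \<in> V" for w
    using that by (cases rule: V_cases) (auto simp: y_def i axis_def)
  have "val y a < val y b" if ab: "(a, b) \<in> D" for a b
  proof -
    have abV: "a \<in> V" "b \<in> V" using ab DV by auto
    have "a \<noteq> b" using x(2)[OF ab] by auto
    have "(if a = v then r else 0) \<le> (if b = v then r else 0)"
    proof (cases "v \<in> sources D V")
      case True
      then have "b \<noteq> v" using ab abV by (auto simp: sources_def)
      then show ?thesis using True r_sign by simp
    next
      case False
      then have "a \<noteq> v" using v ab abV by (auto simp: sinks_def)
      then show ?thesis using False r_sign by simp
    qed
    then show ?thesis using x(2)[OF ab] val abV by simp
  qed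
  then show ?thesis using orient_eqI[OF DA yP] \<open>R \<le> norm y\<close> by blast
qed

lemma far_admissible_eq:
  "{D \<in> admissible. \<forall>R. \<exists>x\<in>generic. R \<le> norm x \<and> orient x = D} = admissible - bipolar"
proof -
  have "D \<notin> bipolar" if far: "\<forall>R. \<exists>x\<in>generic. R \<le> norm x \<and> orient x = D" for D
  proof
    assume "D \<in> bipolar"
    obtain x where "x \<in> generic" "real CARD('a) + 1 \<le> norm x" "orient x = D" using far by blast
    then show False using bipolar_bounded[of x] \<open>D \<in> bipolar\<close> by simp
  qed
  then show ?thesis using not_bipolar_unbounded by blast
qed

lemma card_visibility_sets:
  "real (card (visibility_sets (function_space P) (order_polytope P))) =
   1/2 * real (num_acyclic_orientations E)"
proof -
  have "card (visibility_sets (function_space P) (order_polytope P)) = card admissible"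
    by (simp add: visibility_sets_eq card_image[OF inj_on_visibility])
  then show ?thesis
    using num_acyclic_orientations_eq_twice[OF simple_graph_E edge_01] by (simp add: admissible_def)
qed

lemma card_far_visibility_sets:
  "real (card (far_visibility_sets (function_space P) (order_polytope P))) =
   1/2 * real (num_acyclic_orientations E) - beta_invariant V E"
proof -
  have "card (far_visibility_sets (function_space P) (order_polytope P)) = card (admissible - bipolar)"
    unfolding far_visibility_sets_eq far_admissible_eq
    by (rule card_image[OF inj_on_subset[OF inj_on_visibility]]) simp
  also have "\<dots> = card admissible - card bipolar"
    using finite_admissible bipolar_subset by (intro card_Diff_subset) (auto intro: finite_subset)
  finally have "real (card (far_visibility_sets (function_space P) (order_polytope P))) =
      real (card admissible) - real (card bipolar)"
    using card_mono[OF finite_admissible bipolar_subset] by simp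
  then show ?thesis
    using num_acyclic_orientations_eq_twice[OF simple_graph_E edge_01]
      beta_invariant_eq_card_bipolar[OF simple_graph_E connected_graph_E edge_01]
    by (simp add: admissible_def bipolar_def)
qed

end

theorem corollary1p3:
  fixes P :: "'a::{finite,order} set"
  shows "\<exists>(V :: nat set) E. simple_graph V E \<and> connected_graph V E \<and>
    real (card (visibility_sets (function_space P) (order_polytope P))) =
      1/2 * real (num_acyclic_orientations E) \<and>
    real (card (far_visibility_sets (function_space P) (order_polytope P))) =
      1/2 * real (num_acyclic_orientations E) - beta_invariant V E"
proof -
  obtain f :: "'a \<Rightarrow> nat" where "inj f"
    using finite_imp_inj_to_nat_seg[of "UNIV :: 'a set"] by auto
  \<comment> \<open>The shift by 2 keeps the codes 0 and 1 free for the bottom and the top.\<close>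
  then have "inj (\<lambda>i. f i + 2)" by (simp add: inj_def)
  then interpret hat_poset P "\<lambda>i. f i + 2" by unfold_locales simp_all
  show ?thesis
    by (intro exI conjI)
       (rule simple_graph_E connected_graph_E card_visibility_sets card_far_visibility_sets)+
qed

end
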